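(* Let $G$ be a map on an orientable surface, let $D,D'$ be orientations of its primal-dual completion $\hat G$ such that $D$ is a Schnyder orientation, and let $T=D\setminus D'$. Then: (1) $D'$ is a Schnyder orientation if and only if $T$ is partitionable; (2) $D'$ is a Schnyder orientation having the same outdegrees as $D$ if and only if $T$ is Eulerian-partitionable; (3) for any fixed set $\{B_1,\ldots,B_{2g}\}$ of cycles of $G$ forming a basis for the homology, $D'$ is a Schnyder orientation having the same outdegrees and the same type as $D$ if and only if $T$ is $0$-homologous (i.e. $D$ and $D'$ are homologous).
   Context: A map is a graph embedded on an orientable surface of genus $g$ with all faces homeomorphic to open disks; maps have no contractible cycles of length 1 or 2. An angle of $G$ is a face corner; an angle labeling is a map $\ell$ from angles to $\mathbb{Z}_3$. Each edge has four incident angles; it is of type 0 if all four labels are equal, of type 1 or 2 if in clockwise order they read $i-1,i,i,i+1$ (type 1 if the two $i$'s are at the same extremity, type 2 if on the same side). The labeling is EDGE if every edge is of type 0, 1 or 2. The primal-dual completion $\hat G$: embed $G$ and $G^*$ simultaneously, each edge crossing its dual once, crossing points becoming edge-vertices (degree 4); other vertices are primal-vertices (of $G$) or dual-vertices (of $G^*$); each edge of $\hat G$ joins an edge-vertex to a primal- or dual-vertex; each face of $\hat G$ corresponds to an angle of $G$. A Schnyder orientation of $\hat G$ is an orientation for which there is an EDGE angle labeling $\ell$ of $G$ such that each edge of $\hat G$ separating faces corresponding to angles $a,a'$ is oriented away from its edge-vertex iff $\ell(a)=\ell(a')$ (and towards it otherwise). Homology of a map $H$: fix a reference orientation; flows are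 vectors of $\mathbb{Z}^{E(H)}$; an oriented subgraph (set of edges each with a direction) or a walk has a characteristic flow $\phi$ (entry $+1$/$-1$ per traversal along/against the reference orientation). $\mathbb{F}$ is the subgroup generated by characteristic flows of counterclockwise facial walks; two flows are homologous if their difference lies in $\mathbb{F}$; $0$-homologous means lying in $\mathbb{F}$. A basis for the homology is a set of closed walks whose classes generate (closed-walk flows)$/\mathbb{F}$. For orientations $D,D'$, $D\setminus D'$ is the oriented subgraph of $D$ formed by the edges oriented differently in $D'$ (with their orientation in $D$); $D,D'$ are homologous if $D\setminus D'$ is $0$-homologous. An oriented subgraph $T$ is partitionable if its edge set can be partitioned into $T_0,T_1,T_2$ with $\phi(T_i)-\phi(T_j)\in\mathbb{F}$ for all $i,j$; it is Eulerian-partitionable if moreover each $T_i$ is Eulerian (every vertex has equal in- and outdegree in $T_i$). For a cycle $C$ of $G$ with a direction, $\hat C$ is its subdivision in $\hat G$ and $\gamma(C)$ is the number of edges of $\hat G$ not in $\hat C$ oriented away from a vertex of $\hat C$ on the right of $\hat C$ minus the number of such edges on the left. An orientation of $\hat G$ has type $(\gamma(B_1),\ldots,\gamma(B_{2g}))$ with respect to the basis $\{B_1,\ldots,B_{2g}\}$. *)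

theory Defs
  imports
    "HOL-Combinatorics.Orbits"
    "HOL-Library.Numeral_Type"
    "HOL-Library.Function_Algebras"
    "HOL-Computational_Algebra.Group_Closure"
begin

section \<open>Maps on orientable surfaces\<close>

text \<open>
  A graph embedded on an oriented surface with all faces homeomorphic to open disks is encoded
  by its rotation system. Every edge consists of two opposite darts, exchanged by \<open>opp\<close>, and a dart
  starts at its tail; \<open>nxt d\<close> is the dart that follows \<open>d\<close> in counterclockwise order around
  the tail of \<open>d\<close>. Vertices are the orbits of \<open>nxt\<close>. The face lying to the left of a dart \<open>d\<close>
  is traversed counterclockwise by iterating \<open>face_nxt\<close> from \<open>d\<close>.
  The empty set of darts encodes the map with a single vertex on the sphere.
\<close>

record 'd cmap =
  darts :: "'d set"
  opp :: "'d \<Rightarrow> 'd"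
  nxt :: "'d \<Rightarrow> 'd"

definition prv :: "'d cmap \<Rightarrow> 'd \<Rightarrow> 'd" where
  "prv H = inv (nxt H)"

definition face_nxt :: "'d cmap \<Rightarrow> 'd \<Rightarrow> 'd" where
  "face_nxt H d = prv H (opp H d)"

definition combinatorial_map :: "'d cmap \<Rightarrow> bool" where
  "combinatorial_map H \<longleftrightarrow>
     finite (darts H) \<and> opp H permutes darts H \<and> nxt H permutes darts H \<and>
     (\<forall>d\<in>darts H. opp H d \<noteq> d \<and> opp H (opp H d) = d) \<and>
     (\<forall>d\<in>darts H. \<forall>e\<in>darts H. (d, e) \<in> {(x, y). y = opp H x \<or> y = nxt H x}\<^sup>*)"

definition tail :: "'d cmap \<Rightarrow> 'd \<Rightarrow> 'd set" where
  "tail H d = orbit (nxt H) d"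

definition head :: "'d cmap \<Rightarrow> 'd \<Rightarrow> 'd set" where
  "head H d = tail H (opp H d)"

definition vertices :: "'d cmap \<Rightarrow> 'd set set" where
  "vertices H = tail H ` darts H"

definition edges :: "'d cmap \<Rightarrow> 'd set set" where
  "edges H = (\<lambda>d. {d, opp H d}) ` darts H"

definition faces :: "'d cmap \<Rightarrow> 'd set set" where
  "faces H = (\<lambda>d. orbit (face_nxt H) d) ` darts H"

text \<open>Euler's formula; the map without darts has one vertex and one face, so its genus is 0.\<close>

definition genus :: "'d cmap \<Rightarrow> nat" where
  "genus H = (if darts H = {} then 0
     else nat ((2 - (int (card (vertices H)) - int (card (edges H)) + int (card (faces H)))) div 2))"

definition closed_walk :: "'d cmap \<Rightarrow> 'd list \<Rightarrow> bool" where
  "closed_walk H w \<longleftrightarrow> set w \<subseteq> darts H \<and>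
     (\<forall>i<length w. head H (w ! i) = tail H (w ! (Suc i mod length w)))"

text \<open>A cycle with a direction: neither a vertex nor an edge is repeated.\<close>

definition cycle :: "'d cmap \<Rightarrow> 'd list \<Rightarrow> bool" where
  "cycle H w \<longleftrightarrow> w \<noteq> [] \<and> closed_walk H w \<and> distinct (map (tail H) w) \<and>
     (\<forall>d\<in>set w. opp H d \<notin> set w)"

definition facial_walk :: "'d cmap \<Rightarrow> 'd \<Rightarrow> 'd list" where
  "facial_walk H d = map (\<lambda>k. (face_nxt H ^^ k) d) [0..<card (orbit (face_nxt H) d)]"

text \<open>
  Homotopy of closed walks to a point: the surface is a 2-complex whose 2-cells are the faces, so
  homotopies are generated by inserting and deleting backtracks and facial walks.
\<close>

inductive contractible :: "'d cmap \<Rightarrow> 'd list \<Rightarrow> bool" for H where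
  Nil: "contractible H []"
| ins_backtrack: "contractible H (u @ v) \<Longrightarrow> closed_walk H (u @ [d, opp H d] @ v) \<Longrightarrow>
    contractible H (u @ [d, opp H d] @ v)"
| del_backtrack: "contractible H (u @ [d, opp H d] @ v) \<Longrightarrow> contractible H (u @ v)"
| ins_face: "contractible H (u @ v) \<Longrightarrow> closed_walk H (u @ facial_walk H d @ v) \<Longrightarrow>
    contractible H (u @ facial_walk H d @ v)"
| del_face: "contractible H (u @ facial_walk H d @ v) \<Longrightarrow> contractible H (u @ v)"

definition surface_map :: "'d cmap \<Rightarrow> bool" where
  "surface_map G \<longleftrightarrow> combinatorial_map G \<and>
     (\<forall>w. cycle G w \<and> length w \<in> {1, 2} \<longrightarrow> \<not> contractible G w)"


section \<open>Orientations and homology\<close>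

text \<open>
  An edge with a direction is a dart, so an oriented subgraph is a set of darts.
\<close>

definition orientation :: "'d cmap \<Rightarrow> 'd set \<Rightarrow> bool" where
  "orientation H D \<longleftrightarrow> D \<subseteq> darts H \<and> (\<forall>d\<in>darts H. d \<in> D \<longleftrightarrow> opp H d \<notin> D)"

definition orientation_diff :: "'d cmap \<Rightarrow> 'd set \<Rightarrow> 'd set \<Rightarrow> 'd set" where
  "orientation_diff H D D' = {d \<in> D. opp H d \<in> D'}"

definition outdeg :: "'d cmap \<Rightarrow> 'd set \<Rightarrow> 'd set \<Rightarrow> nat" where
  "outdeg H T v = card {d \<in> T. tail H d = v}"

definition indeg :: "'d cmap \<Rightarrow> 'd set \<Rightarrow> 'd set \<Rightarrow> nat" where
  "indeg H T v = card {d \<in> T. head H d = v}"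

definition same_outdegrees :: "'d cmap \<Rightarrow> 'd set \<Rightarrow> 'd set \<Rightarrow> bool" where
  "same_outdegrees H D D' \<longleftrightarrow> (\<forall>v\<in>vertices H. outdeg H D v = outdeg H D' v)"

definition eulerian :: "'d cmap \<Rightarrow> 'd set \<Rightarrow> bool" where
  "eulerian H T \<longleftrightarrow> (\<forall>v\<in>vertices H. outdeg H T v = indeg H T v)"

text \<open>
  Flows are taken relative to a reference orientation \<open>R\<close>: the coordinate of an edge is the value
  at its dart in \<open>R\<close>, and a flow vanishes at all darts outside \<open>R\<close>.
\<close>

definition subgraph_flow :: "'d cmap \<Rightarrow> 'd set \<Rightarrow> 'd set \<Rightarrow> 'd \<Rightarrow> int" where
  "subgraph_flow H R T =
     (\<lambda>e. if e \<in> R then of_bool (e \<in> T) - of_bool (opp H e \<in> T) else 0)"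

definition walk_flow :: "'d cmap \<Rightarrow> 'd set \<Rightarrow> 'd list \<Rightarrow> 'd \<Rightarrow> int" where
  "walk_flow H R w =
     (\<lambda>e. if e \<in> R then int (count_list w e) - int (count_list w (opp H e)) else 0)"

definition face_flows :: "'d cmap \<Rightarrow> 'd set \<Rightarrow> ('d \<Rightarrow> int) set" where
  "face_flows H R = group_closure ((\<lambda>d. walk_flow H R (facial_walk H d)) ` darts H)"

definition closed_walk_flows :: "'d cmap \<Rightarrow> 'd set \<Rightarrow> ('d \<Rightarrow> int) set" where
  "closed_walk_flows H R = group_closure {walk_flow H R w | w. closed_walk H w}"

definition homologous :: "'d cmap \<Rightarrow> 'd set \<Rightarrow> ('d \<Rightarrow> int) \<Rightarrow> ('d \<Rightarrow> int) \<Rightarrow> bool" where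
  "homologous H R x y \<longleftrightarrow> x - y \<in> face_flows H R"

definition zero_homologous :: "'d cmap \<Rightarrow> 'd set \<Rightarrow> 'd set \<Rightarrow> bool" where
  "zero_homologous H R T \<longleftrightarrow> subgraph_flow H R T \<in> face_flows H R"

definition homology_basis :: "'d cmap \<Rightarrow> 'd set \<Rightarrow> 'd list list \<Rightarrow> bool" where
  "homology_basis H R Bs \<longleftrightarrow> (\<forall>B\<in>set Bs. closed_walk H B) \<and>
     (\<forall>x\<in>closed_walk_flows H R. \<exists>y\<in>group_closure (walk_flow H R ` set Bs). homologous H R x y)"

definition partitionable :: "'d cmap \<Rightarrow> 'd set \<Rightarrow> 'd set \<Rightarrow> bool" where
  "partitionable H R T \<longleftrightarrow> (\<exists>P :: 3 \<Rightarrow> 'd set.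
     T = (\<Union>i. P i) \<and> (\<forall>i j. i \<noteq> j \<longrightarrow> P i \<inter> P j = {}) \<and>
     (\<forall>i j. homologous H R (subgraph_flow H R (P i)) (subgraph_flow H R (P j))))"

definition eulerian_partitionable :: "'d cmap \<Rightarrow> 'd set \<Rightarrow> 'd set \<Rightarrow> bool" where
  "eulerian_partitionable H R T \<longleftrightarrow> (\<exists>P :: 3 \<Rightarrow> 'd set.
     T = (\<Union>i. P i) \<and> (\<forall>i j. i \<noteq> j \<longrightarrow> P i \<inter> P j = {}) \<and>
     (\<forall>i j. homologous H R (subgraph_flow H R (P i)) (subgraph_flow H R (P j))) \<and>
     (\<forall>i. eulerian H (P i)))"


section \<open>Angle labelings\<close>

text \<open>
  The angle between \<open>d\<close> and \<open>nxt d\<close> is denoted by the dart \<open>d\<close>. In clockwise order, the four angles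
  incident to the edge of \<open>d\<close> are \<open>d\<close> (at the tail, on the left), \<open>prv (opp d)\<close> (at the head, on
  the left), \<open>opp d\<close> (at the head, on the right) and \<open>prv d\<close> (at the tail, on the right). Replacing
  \<open>d\<close> by \<open>opp d\<close> rotates this list by two positions.
\<close>

definition edge_type0 :: "'d cmap \<Rightarrow> ('d \<Rightarrow> 3) \<Rightarrow> 'd \<Rightarrow> bool" where
  "edge_type0 G l d \<longleftrightarrow>
     l d = l (prv G (opp G d)) \<and> l d = l (opp G d) \<and> l d = l (prv G d)"

definition edge_type1 :: "'d cmap \<Rightarrow> ('d \<Rightarrow> 3) \<Rightarrow> 'd \<Rightarrow> bool" where
  "edge_type1 G l d \<longleftrightarrow> (\<exists>i. \<exists>e\<in>{d, opp G d}.
     l e = i - 1 \<and> l (prv G (opp G e)) = i \<and> l (opp G e) = i \<and> l (prv G e) = i + 1)"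

definition edge_type2 :: "'d cmap \<Rightarrow> ('d \<Rightarrow> 3) \<Rightarrow> 'd \<Rightarrow> bool" where
  "edge_type2 G l d \<longleftrightarrow> (\<exists>i. \<exists>e\<in>{d, opp G d}.
     l (prv G e) = i - 1 \<and> l e = i \<and> l (prv G (opp G e)) = i \<and> l (opp G e) = i + 1)"

definition EDGE_labeling :: "'d cmap \<Rightarrow> ('d \<Rightarrow> 3) \<Rightarrow> bool" where
  "EDGE_labeling G l \<longleftrightarrow>
     (\<forall>d\<in>darts G. edge_type0 G l d \<or> edge_type1 G l d \<or> edge_type2 G l d)"


section \<open>The primal-dual completion\<close>

text \<open>
  Every dart \<open>d\<close> of \<open>G\<close> gives rise to two edges of the completion: one joins the tail of \<open>d\<close> to the
  edge-vertex of \<open>d\<close> (darts \<open>V2E d\<close> and \<open>E2V d\<close>), the other joins the dual-vertex of the face on the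
  left of \<open>d\<close> to the edge-vertex of \<open>d\<close> (darts \<open>F2E d\<close> and \<open>E2F d\<close>).
\<close>

datatype 'd pd_dart = V2E 'd | E2V 'd | F2E 'd | E2F 'd

definition pd_darts :: "'d cmap \<Rightarrow> 'd pd_dart set" where
  "pd_darts G = V2E ` darts G \<union> E2V ` darts G \<union> F2E ` darts G \<union> E2F ` darts G"

fun pd_opp :: "'d pd_dart \<Rightarrow> 'd pd_dart" where
  "pd_opp (V2E d) = E2V d"
| "pd_opp (E2V d) = V2E d"
| "pd_opp (F2E d) = E2F d"
| "pd_opp (E2F d) = F2E d"

text \<open>
  Counterclockwise around the edge-vertex of \<open>d\<close>: \<open>E2V (opp d)\<close>, \<open>E2F d\<close>, \<open>E2V d\<close>, \<open>E2F (opp d)\<close>.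
\<close>

fun pd_nxt :: "'d cmap \<Rightarrow> 'd pd_dart \<Rightarrow> 'd pd_dart" where
  "pd_nxt G (V2E d) = V2E (nxt G d)"
| "pd_nxt G (E2V d) = E2F (opp G d)"
| "pd_nxt G (F2E d) = F2E (face_nxt G d)"
| "pd_nxt G (E2F d) = E2V d"

definition pd_completion :: "'d cmap \<Rightarrow> 'd pd_dart cmap" where
  "pd_completion G = \<lparr>darts = pd_darts G,
     opp = perm_restrict pd_opp (pd_darts G),
     nxt = perm_restrict (pd_nxt G) (pd_darts G)\<rparr>"

lemma pd_completion_simps: "darts (pd_completion G) = pd_darts G"
 "opp (pd_completion G) = perm_restrict pd_opp (pd_darts G)"
 "nxt (pd_completion G) = perm_restrict (pd_nxt G) (pd_darts G)"
  by (simp_all add: pd_completion_def)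

lemma combinatorial_map_pd_completion:
  assumes "combinatorial_map G"
  shows "combinatorial_map (pd_completion G)"
proof -
  note G = assms[unfolded combinatorial_map_def]
  have o: "opp G permutes darts G" and n: "nxt G permutes darts G" and fin: "finite (darts G)"
    and inv: "\<And>d. d \<in> darts G \<Longrightarrow> opp G (opp G d) = d" using G by auto
  have f: "face_nxt G permutes darts G"
  proof -
    have "face_nxt G = inv (nxt G) \<circ> opp G" by (auto simp: face_nxt_def prv_def)
    then show ?thesis using permutes_compose[OF o permutes_inv[OF n]] by simp
  qed
  have oin: "opp G d \<in> darts G \<longleftrightarrow> d \<in> darts G" for d by (rule permutes_in_image[OF o])
  have nin: "nxt G d \<in> darts G \<longleftrightarrow> d \<in> darts G" for d by (rule permutes_in_image[OF n])
  have fnin: "face_nxt G d \<in> darts G \<longleftrightarrow> d \<in> darts G" for d by (rule permutes_in_image[OF f])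
  have finpd: "finite (pd_darts G)" using fin by (simp add: pd_darts_def)
  have po: "perm_restrict pd_opp (pd_darts G) permutes pd_darts G"
  proof (rule bij_imp_permutes)
    show "bij_betw (perm_restrict pd_opp (pd_darts G)) (pd_darts G) (pd_darts G)"
      by (rule bij_betwI[where g = pd_opp])
        (auto simp: pd_darts_def perm_restrict_def)
  qed (simp add: perm_restrict_def)
  have pn: "perm_restrict (pd_nxt G) (pd_darts G) permutes pd_darts G"
  proof (rule bij_imp_permutes)
    have "inj_on (perm_restrict (pd_nxt G) (pd_darts G)) (pd_darts G)"
      by (auto simp: inj_on_def pd_darts_def perm_restrict_def inj_eq[OF permutes_inj[OF o]]
          inj_eq[OF permutes_inj[OF n]] inj_eq[OF permutes_inj[OF f]])
    moreover have "perm_restrict (pd_nxt G) (pd_darts G) ` pd_darts G \<subseteq> pd_darts G"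
      by (auto simp: pd_darts_def perm_restrict_def oin nin fnin)
    ultimately show "bij_betw (perm_restrict (pd_nxt G) (pd_darts G)) (pd_darts G) (pd_darts G)"
      using finpd by (simp add: bij_betw_def endo_inj_surj)
  qed (simp add: perm_restrict_def)
  let ?r = "{(x, y). y = opp (pd_completion G) x \<or> y = nxt (pd_completion G) x}\<^sup>*"
  have s1: "(x, pd_opp x) \<in> ?r" if "x \<in> pd_darts G" for x
    using that by (intro r_into_rtrancl) (auto simp: pd_completion_simps perm_restrict_def)
  have s2: "(x, pd_nxt G x) \<in> ?r" if "x \<in> pd_darts G" for x
    using that by (intro r_into_rtrancl) (auto simp: pd_completion_simps perm_restrict_def)
  have pd: "V2E d \<in> pd_darts G" "E2V d \<in> pd_darts G" "F2E d \<in> pd_darts G" "E2F d \<in> pd_darts G"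
    if "d \<in> darts G" for d using that by (auto simp: pd_darts_def)
  have a: "(V2E d, E2V d) \<in> ?r" "(E2V d, V2E d) \<in> ?r" "(F2E d, E2F d) \<in> ?r" "(E2F d, F2E d) \<in> ?r"
    "(E2F d, E2V d) \<in> ?r" "(E2V d, E2F (opp G d)) \<in> ?r" "(V2E d, V2E (nxt G d)) \<in> ?r"
    if "d \<in> darts G" for d
    using s1[OF pd(1)[OF that]] s1[OF pd(2)[OF that]] s1[OF pd(3)[OF that]] s1[OF pd(4)[OF that]]
      s2[OF pd(4)[OF that]] s2[OF pd(2)[OF that]] s2[OF pd(1)[OF that]] by simp_all
  have b: "(V2E d, V2E (opp G d)) \<in> ?r" "(V2E d, E2F d) \<in> ?r" if "d \<in> darts G" for d
  proof -
    have od: "opp G d \<in> darts G" using that oin by simp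
    have "(V2E d, E2F (opp G d)) \<in> ?r" using a(1,6)[OF that] by (rule rtrancl_trans)
    then have "(V2E d, E2V (opp G d)) \<in> ?r" using a(5)[OF od] by (rule rtrancl_trans)
    note c = this
    from c a(2)[OF od] show "(V2E d, V2E (opp G d)) \<in> ?r" by (rule rtrancl_trans)
    show "(V2E d, E2F d) \<in> ?r" using rtrancl_trans[OF c a(6)[OF od]] inv[OF that] by simp
  qed
  have vv: "(V2E d, V2E e) \<in> ?r" if "d \<in> darts G" "e \<in> darts G" for d e
  proof -
    have "(d, e) \<in> {(x, y). y = opp G x \<or> y = nxt G x}\<^sup>*" using G that by simp
    then have "e \<in> darts G \<and> (V2E d, V2E e) \<in> ?r"
    proof induction
      case base then show ?case using that by simp
    next
      case (step y z)
      then have y: "y \<in> darts G" by simp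
      then have "(V2E y, V2E z) \<in> ?r" "z \<in> darts G"
        using step(2) b(1)[OF y] a(7)[OF y] oin nin by auto
      then show ?case using step.IH rtrancl_trans[of "V2E d" "V2E y" _ "V2E z"] by simp
    qed
    then show ?thesis by simp
  qed
  have c1: "\<exists>d\<in>darts G. (x, V2E d) \<in> ?r" if "x \<in> pd_darts G" for x
  proof -
    have e: "(E2F d, V2E d) \<in> ?r" if "d \<in> darts G" for d
      by (rule rtrancl_trans[OF a(5)[OF that] a(2)[OF that]])
    have f: "(F2E d, V2E d) \<in> ?r" if "d \<in> darts G" for d
      by (rule rtrancl_trans[OF a(3)[OF that] e[OF that]])
    have "x = V2E d \<or> x = E2V d \<or> x = F2E d \<or> x = E2F d \<Longrightarrow> d \<in> darts G \<Longrightarrow> ?thesis" for d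
      by (rule bexI[of _ d]) (use a(2) e f in auto)
    then show ?thesis using that unfolding pd_darts_def by (elim UnE imageE) simp_all
  qed
  have c2: "\<exists>d\<in>darts G. (V2E d, x) \<in> ?r" if "x \<in> pd_darts G" for x
  proof -
    have f: "(V2E d, F2E d) \<in> ?r" if "d \<in> darts G" for d
      by (rule rtrancl_trans[OF b(2)[OF that] a(4)[OF that]])
    have "x = V2E d \<or> x = E2V d \<or> x = F2E d \<or> x = E2F d \<Longrightarrow> d \<in> darts G \<Longrightarrow> ?thesis" for d
      by (rule bexI[of _ d]) (use a(1) b(2) f in auto)
    then show ?thesis using that unfolding pd_darts_def by (elim UnE imageE) simp_all
  qed
  have "(x, y) \<in> ?r" if xy: "x \<in> pd_darts G" "y \<in> pd_darts G" for x y
  proof -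
    obtain d e where de: "d \<in> darts G" "e \<in> darts G" "(x, V2E d) \<in> ?r" "(V2E e, y) \<in> ?r"
      using c1[OF xy(1)] c2[OF xy(2)] by (elim bexE) simp
    show ?thesis by (rule rtrancl_trans[OF de(3) rtrancl_trans[OF vv[OF de(1,2)] de(4)]])
  qed
  moreover have "\<forall>d\<in>pd_darts G. perm_restrict pd_opp (pd_darts G) d \<noteq> d \<and>
    perm_restrict pd_opp (pd_darts G) (perm_restrict pd_opp (pd_darts G) d) = d"
    by (auto simp: pd_darts_def perm_restrict_def)
  ultimately show ?thesis
    unfolding combinatorial_map_def using finpd po pn by (simp add: pd_completion_simps)
qed

text \<open>The angle of \<open>G\<close> corresponding to the face on the left of a dart of the completion.\<close>

fun pd_angle :: "'d cmap \<Rightarrow> 'd pd_dart \<Rightarrow> 'd" where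
  "pd_angle G (V2E d) = d"
| "pd_angle G (E2V d) = prv G d"
| "pd_angle G (F2E d) = prv G (opp G d)"
| "pd_angle G (E2F d) = d"

lemma pd_angle_face_nxt:
  assumes G: "combinatorial_map G" and x: "x \<in> darts (pd_completion G)"
  shows "pd_angle G (face_nxt (pd_completion G) x) = pd_angle G x"
proof -
  have o: "opp G permutes darts G" and n: "nxt G permutes darts G"
    and inv: "\<And>d. d \<in> darts G \<Longrightarrow> opp G (opp G d) = d"
    using G by (auto simp: combinatorial_map_def)
  have oin: "opp G d \<in> darts G \<longleftrightarrow> d \<in> darts G" for d by (rule permutes_in_image[OF o])
  have nin: "nxt G d \<in> darts G \<longleftrightarrow> d \<in> darts G" for d by (rule permutes_in_image[OF n])
  have np: "nxt G (prv G d) = d" "prv G (nxt G d) = d" for d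
    unfolding prv_def using permutes_inverses[OF n] by auto
  have pin: "prv G d \<in> darts G \<longleftrightarrow> d \<in> darts G" for d using nin np by metis
  have pn: "nxt (pd_completion G) permutes darts (pd_completion G)"
    using combinatorial_map_pd_completion[OF G] by (simp add: combinatorial_map_def)
  have key: "face_nxt (pd_completion G) x = y"
    if "y \<in> pd_darts G" "pd_nxt G y = pd_opp x" for y
  proof -
    have "nxt (pd_completion G) y = opp (pd_completion G) x"
      using that x by (simp add: pd_completion_simps perm_restrict_def)
    then show ?thesis unfolding face_nxt_def[of "pd_completion G"] prv_def[of "pd_completion G"]
      using permutes_inverses(2)[OF pn, of y] by simp
  qed
  from x show ?thesis
    unfolding pd_completion_simps pd_darts_def
  proof (elim UnE imageE)
    fix d assume "x = V2E d" "d \<in> darts G"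
    then show ?thesis using key[of "E2F d"] by (simp add: pd_darts_def)
  next
    fix d assume "x = E2V d" "d \<in> darts G"
    then show ?thesis using key[of "V2E (prv G d)"] by (simp add: pd_darts_def np pin)
  next
    fix d assume "x = F2E d" "d \<in> darts G"
    then show ?thesis using key[of "E2V (opp G d)"] by (simp add: pd_darts_def oin inv)
  next
    fix d assume "x = E2F d" "d \<in> darts G"
    then show ?thesis using key[of "F2E (opp G (nxt G d))"]
      by (simp add: pd_darts_def oin nin inv np face_nxt_def)
  qed
qed

fun from_edge_vertex :: "'d pd_dart \<Rightarrow> bool" where
  "from_edge_vertex (V2E d) = False"
| "from_edge_vertex (E2V d) = True"
| "from_edge_vertex (F2E d) = False"
| "from_edge_vertex (E2F d) = True"

definition schnyder_orientation :: "'d cmap \<Rightarrow> 'd pd_dart set \<Rightarrow> bool" where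
  "schnyder_orientation G D \<longleftrightarrow> orientation (pd_completion G) D \<and>
     (\<exists>l. EDGE_labeling G l \<and>
       (\<forall>x\<in>darts (pd_completion G). from_edge_vertex x \<longrightarrow>
         (x \<in> D \<longleftrightarrow> l (pd_angle G x) = l (pd_angle G (opp (pd_completion G) x)))))"


section \<open>The type of an orientation\<close>

text \<open>The dart \<open>x\<close> is met when turning counterclockwise from \<open>a\<close> until \<open>b\<close>, both excluded.\<close>

definition ccw_between :: "'d cmap \<Rightarrow> 'd \<Rightarrow> 'd \<Rightarrow> 'd \<Rightarrow> bool" where
  "ccw_between H a b x \<longleftrightarrow>
     (\<exists>k\<ge>1. x = (nxt H ^^ k) a \<and> (\<forall>j\<in>{1..k}. (nxt H ^^ j) a \<noteq> b))"

definition starts_left :: "'d cmap \<Rightarrow> 'd list \<Rightarrow> 'd \<Rightarrow> bool" where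
  "starts_left H C x \<longleftrightarrow> x \<notin> set C \<and> opp H x \<notin> set C \<and>
     (\<exists>i<length C. ccw_between H (C ! (Suc i mod length C)) (opp H (C ! i)) x)"

definition starts_right :: "'d cmap \<Rightarrow> 'd list \<Rightarrow> 'd \<Rightarrow> bool" where
  "starts_right H C x \<longleftrightarrow> x \<notin> set C \<and> opp H x \<notin> set C \<and>
     (\<exists>i<length C. ccw_between H (opp H (C ! i)) (C ! (Suc i mod length C)) x)"

definition subdivision :: "'d cmap \<Rightarrow> 'd list \<Rightarrow> 'd pd_dart list" where
  "subdivision G C = concat (map (\<lambda>d. [V2E d, E2V (opp G d)]) C)"

definition gamma :: "'d cmap \<Rightarrow> 'd pd_dart set \<Rightarrow> 'd list \<Rightarrow> int" where
  "gamma G D C =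
     int (card {x \<in> D. starts_right (pd_completion G) (subdivision G C) x}) -
     int (card {x \<in> D. starts_left (pd_completion G) (subdivision G C) x})"

definition orientation_type :: "'d cmap \<Rightarrow> 'd list list \<Rightarrow> 'd pd_dart set \<Rightarrow> int list" where
  "orientation_type G Bs D = map (gamma G D) Bs"

end

theory Submission
  imports Defs
begin

text \<open>
  The faces of the completion are the angles of the map, so \<open>face_flows\<close> consists of the
  coboundaries of integer functions on the angles. Reading an EDGE labeling as a function on the
  angles with values in the integers modulo 3, an orientation is Schnyder iff the indicator function
  of its darts entering edge-vertices is the coboundary of such a labeling. Passing from \<open>D\<close> to \<open>D'\<close>
  subtracts the flow of \<open>T\<close> from this function. Hence \<open>D'\<close> is Schnyder iff the flow of \<open>T\<close> is a
  coboundary modulo 3, and the level sets of a potential modulo 3 cut \<open>T\<close> into three homologous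
  parts. Coboundaries are conserved at every vertex, which yields the Eulerian version.

  If \<open>T\<close> is Eulerian, its flow \<open>f\<close> is conserved. A local potential of \<open>f\<close> around each vertex turns
  \<open>f\<close> into an antisymmetric function on the darts of \<open>G\<close> that sums to zero around each face, and
  \<open>gamma\<close> changes along a cycle by twice the sum of this function. If these sums vanish on a
  homology basis, they vanish on all closed walks, so the function has a potential on the vertices;
  the two potentials together make \<open>f\<close> a coboundary.
\<close>

section \<open>Preliminaries\<close>

lemma permutes_orbit_self:
  assumes "f permutes S" "finite S"
  shows "x \<in> orbit f x"
  by (rule permutation_self_in_orbit) (use assms permutation_permutes in blast)

lemma permutes_orbit_eq:
  assumes "f permutes S" "finite S" "y \<in> orbit f x"
  shows "orbit f y = orbit f x"
  by (rule orbit_cyclic_eq3[OF cyclic_on_orbit[OF assms(1,2)] assms(3)])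

lemma sum_orbit_shift:
  assumes f: "f permutes S" "finite S"
  shows "(\<Sum>y\<in>orbit f x. g (f y)) = (\<Sum>y\<in>orbit f x. g y)"
proof (rule sum.reindex_bij_betw)
  have "inj_on f (orbit f x)" using permutes_inj[OF f(1)] by (rule inj_on_subset) simp
  moreover have "f ` orbit f x \<subseteq> orbit f x" by (auto intro: orbit.step)
  moreover have "finite (orbit f x)" by (rule finite_orbit[OF permutes_orbit_self[OF f]])
  ultimately show "bij_betw f (orbit f x) (orbit f x)"
    by (simp add: bij_betw_def endo_inj_surj)
qed

text \<open>Along each cycle of \<open>f\<close>, partial sums of \<open>g\<close> from a chosen
  base point have the required increments. The only increment in doubt is the one that returns to
  the base point, and it is right because the total over the cycle vanishes.\<close>

lemma potential_if_orbit_sums_zero: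
  fixes g :: "'a \<Rightarrow> 'b::ab_group_add"
  assumes f: "f permutes S" "finite S"
    and zero: "\<And>x. x \<in> S \<Longrightarrow> (\<Sum>y\<in>orbit f x. g y) = 0"
  obtains p where "\<And>x. x \<in> S \<Longrightarrow> p x - p (inv f x) = g x"
proof -
  note self = permutes_orbit_self[OF f]
  define r where "r c = (SOME y. y \<in> c)" for c :: "'a set"
  have r: "r (orbit f x) \<in> orbit f x" for x
    unfolding r_def using self[of x] by (rule someI)
  \<comment> \<open>The term at the base point is left out and the term at \<open>x\<close> is
    included, so the base point gets potential 0.\<close>
  define p where "p x = (\<Sum>j<funpow_dist f (r (orbit f x)) x. g (f ((f ^^ j) (r (orbit f x)))))" for x
  have step: "p (f x) - p x = g (f x)" if x: "x \<in> S" for x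
  proof -
    define c where "c = r (orbit f x)"
    have oc: "orbit f c = orbit f x" and ofx: "orbit f (f x) = orbit f x"
      unfolding c_def by (rule permutes_orbit_eq[OF f r], rule permutes_orbit_eq[OF f orbit.base])
    have xc: "x \<in> orbit f c" and fxc: "f x \<in> orbit f c" using self oc by (auto intro: orbit.step)
    define m where "m = funpow_dist f c x"
    have m: "(f ^^ m) c = x" unfolding m_def by (rule funpow_dist_prop[OF xc])
    have px: "p x = (\<Sum>j<m. g (f ((f ^^ j) c)))" by (simp add: p_def m_def c_def)
    have pfx: "p (f x) = (\<Sum>j<funpow_dist f c (f x). g (f ((f ^^ j) c)))"
      by (simp add: p_def c_def ofx)
    show ?thesis
    proof (cases "f x = c")
      case False
      then have "funpow_dist f c (f x) = funpow_dist1 f c (f x)"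
        using fxc by (intro funpow_dist_step) auto
      moreover have "funpow_dist f c (f x) = Suc m"
      proof (rule antisym)
        show "funpow_dist f c (f x) \<le> Suc m"
          unfolding funpow_dist_def by (rule Least_le) (simp add: m)
        obtain k where k: "funpow_dist f c (f x) = Suc k" using calculation by simp
        have "(f ^^ Suc k) c = f x" using funpow_dist_prop[OF fxc] k by simp
        then have "(f ^^ k) c = x" using permutes_inj[OF f(1)] by (simp add: inj_eq)
        then have "m \<le> k" unfolding m_def funpow_dist_def by (rule Least_le)
        then show "Suc m \<le> funpow_dist f c (f x)" using k by simp
      qed
      ultimately show ?thesis unfolding px pfx using m by simp
    next
      case True
      \<comment> \<open>\<open>funpow_dist f c c\<close> is 0 although \<open>x\<close>, the
        predecessor of \<open>c\<close>, lies at distance \<open>m\<close>. The length of the cycle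
        is \<open>funpow_dist1 f c c\<close>, so the sum for \<open>x\<close> misses just the term
        at \<open>c\<close>.\<close>
      have "funpow_dist1 f c c = Suc m"
      proof (rule antisym)
        show "funpow_dist1 f c c \<le> Suc m"
          using True m self by (intro funpow_dist1_le_self) auto
        have "(f ^^ funpow_dist1 f c c) c = f x"
          using funpow_dist1_prop[OF self] True by simp
        then have "(f ^^ funpow_dist f (f c) c) c = x"
          using permutes_inj[OF f(1)] by (simp add: inj_eq)
        then show "Suc m \<le> funpow_dist1 f c c"
          unfolding m_def funpow_dist_def[of f c x] by (simp add: Least_le)
      qed
      then have orb: "orbit f c = (\<lambda>n. (f ^^ n) c) ` {0..<Suc m}"
        and inj: "inj_on (\<lambda>n. (f ^^ n) c) {0..<Suc m}"
        using orbit_conv_funpow_dist1[OF self] inj_on_funpow_dist1[OF self] by metis+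
      have "0 = (\<Sum>y\<in>orbit f c. g (f y))"
        using zero[OF x] sum_orbit_shift[OF f, of g c] by (simp add: oc)
      also have "\<dots> = (\<Sum>j<Suc m. g (f ((f ^^ j) c)))"
        unfolding orb sum.reindex[OF inj] by (simp add: lessThan_atLeast0)
      finally have "p x + g (f x) = 0" unfolding px using m by simp
      moreover have "p (f x) = 0" using pfx by (simp add: True funpow_dist_0)
      ultimately show ?thesis by (simp add: add_eq_0_iff)
    qed
  qed
  show thesis
  proof (rule that)
    fix x assume x: "x \<in> S"
    have "inv f x \<in> S" using permutes_in_image[OF permutes_inv[OF f(1)]] x by simp
    from step[OF this] show "p x - p (inv f x) = g x"
      using permutes_inverses(1)[OF f(1)] by simp
  qed
qed

section \<open>Cyclic indices\<close>

lemma bij_betw_Suc_mod: "bij_betw (\<lambda>i. Suc i mod n) {..<n} {..<n}"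
proof (rule bij_betwI[where g = "\<lambda>j. if j = 0 then n - 1 else j - 1"])
  show "(if Suc x mod n = 0 then n - 1 else Suc x mod n - 1) = x" if "x \<in> {..<n}" for x
    using that by (cases "Suc x = n") auto
qed auto

text \<open>Index arithmetic for \<open>subdivision\<close>: a dart at position \<open>i\<close>
  becomes two darts at \<open>2 * i\<close> and \<open>Suc (2 * i)\<close>, and the second is
  followed cyclically by the first half of the next dart.\<close>

lemma Suc_double_mod:
  assumes "i < n"
  shows "Suc (2 * i) mod (2 * n) = Suc (2 * i)"
    "Suc (Suc (2 * i)) mod (2 * n) = 2 * (Suc i mod n)"
proof -
  show "Suc (2 * i) mod (2 * n) = Suc (2 * i)" using assms by simp
  have "Suc (Suc (2 * i)) = 2 * Suc i" by simp
  then show "Suc (Suc (2 * i)) mod (2 * n) = 2 * (Suc i mod n)" by (simp only: mult_mod_right)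
qed

lemma ex_less_double_iff:
  "(\<exists>j<2 * n. P j) \<longleftrightarrow> (\<exists>i<n. P (2 * i)) \<or> (\<exists>i<n. P (Suc (2 * i)))" for n :: nat
proof
  assume "\<exists>j<2 * n. P j"
  then obtain j where j: "j < 2 * n" "P j" by blast
  show "(\<exists>i<n. P (2 * i)) \<or> (\<exists>i<n. P (Suc (2 * i)))"
  proof (cases "even j")
    case True
    then obtain i where "j = 2 * i" by (rule evenE)
    then show ?thesis using j by auto
  next
    case False
    then obtain i where "j = 2 * i + 1" by (rule oddE)
    then show ?thesis using j by auto
  qed
next
  assume "(\<exists>i<n. P (2 * i)) \<or> (\<exists>i<n. P (Suc (2 * i)))"
  then show "\<exists>j<2 * n. P j"
  proof (elim disjE exE conjE)
    fix i assume "i < n" "P (2 * i)"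
    then show ?thesis by (intro exI[of _ "2 * i"]) auto
  next
    fix i assume "i < n" "P (Suc (2 * i))"
    then show ?thesis by (intro exI[of _ "Suc (2 * i)"]) auto
  qed
qed

section \<open>Labels modulo 3\<close>

lemma exhaust_Z3: "x = 0 \<or> x = 1 \<or> x = 2" for x :: 3
proof (cases x)
  case (of_int z)
  then have "z = 0 \<or> z = 1 \<or> z = 2" by auto
  then show ?thesis using of_int by auto
qed

lemma ex_Z3_iff: "(\<exists>x::3. P x) \<longleftrightarrow> P 0 \<or> P 1 \<or> P 2"
  using exhaust_Z3 by metis

text \<open>Going clockwise around an edge, the four successive differences sum to zero modulo 3. If
  each is 0 or 1, then either all are 0, which is type 0, or exactly three are 1, and the place of
  the remaining 0 tells type 1 from type 2.\<close>

lemma edge_labels_iff: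
  fixes a b c e :: 3
  shows "(a = b \<and> a = c \<and> a = e) \<or>
    (\<exists>i. (a = i - 1 \<and> b = i \<and> c = i \<and> e = i + 1) \<or> (c = i - 1 \<and> e = i \<and> a = i \<and> b = i + 1)) \<or>
    (\<exists>i. (e = i - 1 \<and> a = i \<and> b = i \<and> c = i + 1) \<or> (b = i - 1 \<and> c = i \<and> e = i \<and> a = i + 1)) \<longleftrightarrow>
    a - e \<in> {0, 1} \<and> b - a \<in> {0, 1} \<and> c - b \<in> {0, 1} \<and> e - c \<in> {0, 1}"
  unfolding ex_Z3_iff using exhaust_Z3[of a] exhaust_Z3[of b] exhaust_Z3[of c] exhaust_Z3[of e]
  by (elim disjE) simp_all

section \<open>Positions in a subdivided walk\<close>

lemma subdivision_nth:
  "i < length C \<Longrightarrow> subdivision G C ! (2 * i) = V2E (C ! i) \<and>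
    subdivision G C ! Suc (2 * i) = E2V (opp G (C ! i))"
proof (induction C arbitrary: i)
  case (Cons d C)
  then show ?case by (cases i) (auto simp: subdivision_def)
qed simp

lemma length_subdivision: "length (subdivision G C) = 2 * length C"
  by (induction C) (auto simp: subdivision_def)

lemma set_subdivision: "set (subdivision G C) = V2E ` set C \<union> (\<lambda>d. E2V (opp G d)) ` set C"
  by (induction C) (auto simp: subdivision_def)

lemma subdivision_nth_next:
  "i < length C \<Longrightarrow> subdivision G C ! (2 * (Suc i mod length C)) = V2E (C ! (Suc i mod length C))"
  by (intro subdivision_nth[THEN conjunct1] mod_less_divisor) linarith

section \<open>Flows on combinatorial maps\<close>

text \<open>An antisymmetric function on all darts, in place of coordinates relative to a reference
  orientation: \<open>subgraph_flow\<close> is its restriction to \<open>R\<close>, extended by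
  0.\<close>

definition dart_flow :: "'d cmap \<Rightarrow> 'd set \<Rightarrow> 'd \<Rightarrow> int" where
  "dart_flow H T x = of_bool (x \<in> T) - of_bool (opp H x \<in> T)"

lemma dart_flow_partition:
  fixes P :: "3 \<Rightarrow> 'e set"
  assumes "T = (\<Union>i. P i)" "\<forall>i j. i \<noteq> j \<longrightarrow> P i \<inter> P j = {}"
  shows "dart_flow K T x = dart_flow K (P 0) x + dart_flow K (P 1) x + dart_flow K (P 2) x"
proof -
  have "y \<in> T \<longleftrightarrow> y \<in> P 0 \<or> y \<in> P 1 \<or> y \<in> P 2" for y
    using assms(1) ex_Z3_iff[of "\<lambda>i. y \<in> P i"] by simp
  moreover have "\<not> (y \<in> P 0 \<and> y \<in> P 1)" "\<not> (y \<in> P 0 \<and> y \<in> P 2)" "\<not> (y \<in> P 1 \<and> y \<in> P 2)" for y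
    using assms(2)[rule_format, of 0 1] assms(2)[rule_format, of 0 2] assms(2)[rule_format, of 1 2]
    by auto
  ultimately have "of_bool (y \<in> T) = (of_bool (y \<in> P 0) + of_bool (y \<in> P 1) + of_bool (y \<in> P 2) :: int)" for y
    by (auto simp: of_bool_def)
  then show ?thesis by (simp add: dart_flow_def)
qed

text \<open>Used both for the map and, through the interpretation \<open>pd\<close>, for its
  completion, so that the general facts on flows apply to either.\<close>

locale comb_map =
  fixes H :: "'d cmap"
  assumes comb_map: "combinatorial_map H"
begin

section \<open>Vertices and faces as orbits\<close>

lemma finite_darts: "finite (darts H)"
  and opp_permutes: "opp H permutes darts H"
  and nxt_permutes: "nxt H permutes darts H"
  and opp_neq: "d \<in> darts H \<Longrightarrow> opp H d \<noteq> d"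
  and opp_opp: "d \<in> darts H \<Longrightarrow> opp H (opp H d) = d"
  and connected: "d \<in> darts H \<Longrightarrow> e \<in> darts H \<Longrightarrow>
    (d, e) \<in> {(x, y). y = opp H x \<or> y = nxt H x}\<^sup>*"
  using comb_map unfolding combinatorial_map_def by blast+

lemma prv_permutes: "prv H permutes darts H"
  unfolding prv_def by (rule permutes_inv[OF nxt_permutes])

lemma face_nxt_permutes: "face_nxt H permutes darts H"
proof -
  have "face_nxt H = prv H \<circ> opp H" by (auto simp: face_nxt_def)
  then show ?thesis using permutes_compose[OF opp_permutes prv_permutes] by simp
qed

lemma in_darts [simp]:
  "opp H d \<in> darts H \<longleftrightarrow> d \<in> darts H" "nxt H d \<in> darts H \<longleftrightarrow> d \<in> darts H"
  "prv H d \<in> darts H \<longleftrightarrow> d \<in> darts H" "face_nxt H d \<in> darts H \<longleftrightarrow> d \<in> darts H"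
  using permutes_in_image[OF opp_permutes] permutes_in_image[OF nxt_permutes]
    permutes_in_image[OF prv_permutes] permutes_in_image[OF face_nxt_permutes] by auto

lemma nxt_prv [simp]: "nxt H (prv H d) = d" "prv H (nxt H d) = d"
  unfolding prv_def using permutes_inverses[OF nxt_permutes] by auto

lemma tail_self: "d \<in> tail H d"
  unfolding tail_def by (rule permutes_orbit_self[OF nxt_permutes finite_darts])

lemma tail_eq: "e \<in> tail H d \<Longrightarrow> tail H e = tail H d"
  unfolding tail_def by (rule permutes_orbit_eq[OF nxt_permutes finite_darts])

lemma tail_eq_iff: "tail H e = tail H d \<longleftrightarrow> e \<in> tail H d"
  using tail_self[of e] tail_eq[of e d] by auto

lemma tail_nxt: "tail H (nxt H d) = tail H d"
  unfolding tail_eq_iff by (simp add: tail_def orbit.base)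

lemma tail_prv: "tail H (prv H d) = tail H d"
  using tail_nxt[of "prv H d"] by simp

lemma tail_subset: "d \<in> darts H \<Longrightarrow> tail H d \<subseteq> darts H"
  unfolding tail_def by (rule permutes_orbit_subset[OF nxt_permutes])

lemma finite_tail: "finite (tail H d)"
  unfolding tail_def by (rule finite_orbit[OF permutes_orbit_self[OF nxt_permutes finite_darts]])

lemma face_self: "d \<in> orbit (face_nxt H) d"
  by (rule permutes_orbit_self[OF face_nxt_permutes finite_darts])

lemma face_eq_iff: "orbit (face_nxt H) e = orbit (face_nxt H) d \<longleftrightarrow> e \<in> orbit (face_nxt H) d"
  using face_self[of e] permutes_orbit_eq[OF face_nxt_permutes finite_darts, of e d] by auto

lemma set_facial_walk: "set (facial_walk H d) = orbit (face_nxt H) d"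
  and distinct_facial_walk: "distinct (facial_walk H d)"
proof -
  let ?f = "face_nxt H"
  note o = orbit_conv_funpow_dist1[OF face_self[of d]]
  note i = inj_on_funpow_dist1[OF face_self[of d]]
  have c: "card (orbit ?f d) = funpow_dist1 ?f d d" unfolding o card_image[OF i] by simp
  show "set (facial_walk H d) = orbit ?f d" "distinct (facial_walk H d)"
    unfolding facial_walk_def c distinct_map set_map set_upt using o i by simp_all
qed

lemma count_facial_walk:
  "count_list (facial_walk H d) e = of_bool (e \<in> orbit (face_nxt H) d)"
proof -
  have "count_list w e = of_bool (e \<in> set w)" if "distinct w" for w
    using that by (induction w) auto
  from this[OF distinct_facial_walk] show ?thesis by (simp add: set_facial_walk)
qed

section \<open>Face flows as coboundaries\<close>

lemma orientation_opp_iff: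
  assumes "orientation H R" "x \<in> darts H"
  shows "opp H x \<in> R \<longleftrightarrow> x \<notin> R"
  using assms unfolding orientation_def by blast

lemma antisymmetric_eqI:
  fixes f g :: "'d \<Rightarrow> 'b::ab_group_add"
  assumes "orientation H R" and "\<And>x. x \<in> R \<Longrightarrow> f x = g x"
    and "\<And>x. x \<in> darts H \<Longrightarrow> f (opp H x) = - f x" "\<And>x. x \<in> darts H \<Longrightarrow> g (opp H x) = - g x"
    and "x \<in> darts H"
  shows "f x = g x"
proof (cases "x \<in> R")
  case False
  then have "opp H x \<in> R" by (simp add: orientation_opp_iff[OF assms(1,5)])
  then show ?thesis using assms(2)[of "opp H x"] assms(3,4)[OF assms(5)] by simp
qed (rule assms(2))

text \<open>A function on the faces, encoded by values on darts: \<open>K d\<close> belongs to the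
  face on the left of \<open>d\<close>.\<close>

definition face_potential :: "('d \<Rightarrow> int) \<Rightarrow> bool" where
  "face_potential K \<longleftrightarrow> (\<forall>d\<in>darts H. K (face_nxt H d) = K d)"

text \<open>The face on the right of \<open>e\<close> is on the left of \<open>opp H e\<close>, so
  this is the jump of \<open>K\<close> across \<open>e\<close>. It is the boundary of the 2-chain
  with coefficients \<open>K\<close>.\<close>

definition boundary :: "'d set \<Rightarrow> ('d \<Rightarrow> int) \<Rightarrow> 'd \<Rightarrow> int" where
  "boundary R K = (\<lambda>e. if e \<in> R then K e - K (opp H e) else 0)"

lemma walk_flow_facial_walk:
  "walk_flow H R (facial_walk H d) = boundary R (\<lambda>e. of_bool (e \<in> orbit (face_nxt H) d))"
  by (auto simp: walk_flow_def boundary_def count_facial_walk fun_eq_iff)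

text \<open>A facial walk uses once each dart with its face on the left, so its flow comes from the
  indicator of that face. Conversely, \<open>K\<close> is an integer combination of these
  indicators.\<close>

lemma face_flows_iff:
  assumes R: "orientation H R"
  shows "x \<in> face_flows H R \<longleftrightarrow> (\<exists>K. face_potential K \<and> x = boundary R K)"
proof
  assume "x \<in> face_flows H R"
  then show "\<exists>K. face_potential K \<and> x = boundary R K"
    unfolding face_flows_def
  proof induction
    case (base s)
    show ?case
    proof (cases "s = 0")
      case True
      then show ?thesis
        by (intro exI[of _ "\<lambda>_. 0"]) (auto simp: face_potential_def boundary_def fun_eq_iff)
    next
      case False
      then obtain d where d: "d \<in> darts H" "s = walk_flow H R (facial_walk H d)" using base by auto
      have "face_potential (\<lambda>e. of_bool (e \<in> orbit (face_nxt H) d))"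
        unfolding face_potential_def using permutes_orbit_eq[OF face_nxt_permutes finite_darts orbit.base]
        by (simp flip: face_eq_iff)
      then show ?thesis using d(2) unfolding walk_flow_facial_walk by blast
    qed
  next
    case (diff s t)
    then obtain K L where "face_potential K" "s = boundary R K" "face_potential L" "t = boundary R L"
      by blast
    then show ?case
      by (intro exI[of _ "\<lambda>e. K e - L e"])
        (auto simp: face_potential_def boundary_def fun_eq_iff)
  qed
next
  assume "\<exists>K. face_potential K \<and> x = boundary R K"
  then obtain K where K: "face_potential K" and x: "x = boundary R K" by blast
  let ?c = "group_closure ((\<lambda>d. walk_flow H R (facial_walk H d)) ` darts H)"
  have Korb: "K e = K d" if "d \<in> darts H" "e \<in> orbit (face_nxt H) d" for d e
    using that(2)
  proof induction
    case base then show ?case using K that(1) by (simp add: face_potential_def)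
  next
    case (step y)
    have "y \<in> darts H" using permutes_orbit_subset[OF face_nxt_permutes that(1)] step(1) by blast
    then show ?case using K step by (simp add: face_potential_def)
  qed
  have zero: "(\<lambda>e. 0) \<in> ?c"
    using zero_in_group_closure[of "(\<lambda>d. walk_flow H R (facial_walk H d)) ` darts H"]
    by (simp only: zero_fun_def)
  have mult: "(\<lambda>e. n * s e) \<in> ?c" if s: "s \<in> ?c" for n :: int and s
  proof (induction n rule: int_induct[where k = 0])
    case base then show ?case using zero by simp
  next
    case (step1 i)
    from group_closure_add[OF step1(2) s] show ?case
      by (simp add: plus_fun_def algebra_simps)
  next
    case (step2 i)
    from group_closure.diff[OF step2(2) s] show ?case
      by (simp add: fun_diff_def algebra_simps)
  qed
  have sumc: "(\<lambda>e. \<Sum>F\<in>A. s F e) \<in> ?c" if "finite A" "\<And>F. F \<in> A \<Longrightarrow> s F \<in> ?c"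
    for A :: "'d set set" and s
    using that
  proof (induction A rule: finite_induct)
    case empty then show ?case using zero by simp
  next
    case (insert F A)
    then have "s F + (\<lambda>e. \<Sum>F\<in>A. s F e) \<in> ?c" by (intro group_closure_add) auto
    then show ?case using insert.hyps by (simp add: plus_fun_def)
  qed
  \<comment> \<open>A representative dart of each face, at which the coefficient of the face is read
    off.\<close>
  define r where "r F = (SOME d. d \<in> F)" for F :: "'d set"
  have r: "r F \<in> darts H" "orbit (face_nxt H) (r F) = F" if F: "F \<in> faces H" for F
  proof -
    obtain d where d: "d \<in> darts H" "F = orbit (face_nxt H) d" using F by (auto simp: faces_def)
    have "r F \<in> F" unfolding r_def d(2) using face_self[of d] by (rule someI)
    then show "r F \<in> darts H" "orbit (face_nxt H) (r F) = F"
      using d permutes_orbit_subset[OF face_nxt_permutes d(1)] face_eq_iff by auto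
  qed
  have fin: "finite (faces H)" unfolding faces_def using finite_darts by simp
  \<comment> \<open>The faces partition the darts, so only the summand of the face containing
    \<open>e\<close> survives.\<close>
  have K_eq: "(\<Sum>F\<in>faces H. K (r F) * of_bool (e \<in> F)) = K e" if e: "e \<in> darts H" for e
  proof -
    let ?F = "orbit (face_nxt H) e"
    have F: "?F \<in> faces H" using e by (auto simp: faces_def)
    have "(\<Sum>F\<in>faces H. K (r F) * of_bool (e \<in> F)) = (\<Sum>F\<in>faces H. if F = ?F then K (r F) else 0)"
    proof (rule sum.cong)
      fix G assume "G \<in> faces H"
      then have "e \<in> G \<longleftrightarrow> G = ?F" using r(2)[of G] face_eq_iff[of e "r G"] by auto
      then show "K (r G) * of_bool (e \<in> G) = (if G = ?F then K (r G) else 0)" by simp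
    qed simp
    also have "\<dots> = K (r ?F)" using fin F by simp
    also have "\<dots> = K e" using Korb[OF e, of "r ?F"] r(2)[OF F] face_self[of "r ?F"] by simp
    finally show ?thesis .
  qed
  have "(\<lambda>e. \<Sum>F\<in>faces H. K (r F) * walk_flow H R (facial_walk H (r F)) e) \<in> ?c"
    using r(1) by (intro sumc[OF fin] mult group_closure.base) auto
  also have "(\<lambda>e. \<Sum>F\<in>faces H. K (r F) * walk_flow H R (facial_walk H (r F)) e) = x"
  proof
    fix e
    show "(\<Sum>F\<in>faces H. K (r F) * walk_flow H R (facial_walk H (r F)) e) = x e"
    proof (cases "e \<in> R")
      case True
      then have "e \<in> darts H" using R unfolding orientation_def by blast
      then have "x e = (\<Sum>F\<in>faces H. K (r F) * of_bool (e \<in> F)) -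
          (\<Sum>F\<in>faces H. K (r F) * of_bool (opp H e \<in> F))"
        using True by (simp add: x boundary_def K_eq)
      also have "\<dots> = (\<Sum>F\<in>faces H. K (r F) * walk_flow H R (facial_walk H (r F)) e)"
        using True
        by (simp add: walk_flow_facial_walk boundary_def sum_subtractf[symmetric] r(2)
            right_diff_distrib cong: sum.cong)
      finally show ?thesis by simp
    qed (simp add: x boundary_def walk_flow_def)
  qed
  finally show "x \<in> face_flows H R" by (simp add: face_flows_def)
qed

text \<open>The coordinates of flows live on \<open>R\<close>, but both sides of the equation are
  antisymmetric, so it extends to the opposite darts with the same \<open>K\<close>.\<close>

lemma homologous_iff:
  assumes R: "orientation H R"
  shows "homologous H R (subgraph_flow H R P) (subgraph_flow H R Q) \<longleftrightarrow>
    (\<exists>K. face_potential K \<and>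
      (\<forall>e\<in>darts H. dart_flow H P e - dart_flow H Q e = K e - K (opp H e)))"
proof -
  have "subgraph_flow H R P - subgraph_flow H R Q = boundary R K \<longleftrightarrow>
    (\<forall>e\<in>darts H. dart_flow H P e - dart_flow H Q e = K e - K (opp H e))" (is "?l \<longleftrightarrow> ?r") for K
  proof
    assume l: ?l
    show ?r
    proof
      fix e assume "e \<in> darts H"
      show "dart_flow H P e - dart_flow H Q e = K e - K (opp H e)"
      proof (rule antisymmetric_eqI[OF R, where f = "\<lambda>e. dart_flow H P e - dart_flow H Q e"
            and g = "\<lambda>e. K e - K (opp H e)"])
        show "dart_flow H P x - dart_flow H Q x = K x - K (opp H x)" if "x \<in> R" for x
          using fun_cong[OF l, of x] that by (simp add: subgraph_flow_def boundary_def dart_flow_def)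
      qed (use \<open>e \<in> darts H\<close> in \<open>auto simp: dart_flow_def opp_opp\<close>)
    qed
  next
    assume r: ?r
    show ?l
    proof
      fix e
      have "e \<in> R \<Longrightarrow> e \<in> darts H" using R unfolding orientation_def by blast
      then show "(subgraph_flow H R P - subgraph_flow H R Q) e = boundary R K e"
        using r by (simp add: subgraph_flow_def boundary_def flip: dart_flow_def)
    qed
  qed
  then show ?thesis by (simp add: homologous_def face_flows_iff[OF R])
qed

lemma zero_homologous_iff:
  assumes R: "orientation H R"
  shows "zero_homologous H R T \<longleftrightarrow>
    (\<exists>K. face_potential K \<and> (\<forall>e\<in>darts H. dart_flow H T e = K e - K (opp H e)))"
proof -
  have "subgraph_flow H R {} = 0" by (auto simp: subgraph_flow_def fun_eq_iff)
  then have "zero_homologous H R T \<longleftrightarrow> homologous H R (subgraph_flow H R T) (subgraph_flow H R {})"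
    by (simp add: zero_homologous_def homologous_def)
  then show ?thesis by (simp add: homologous_iff[OF R] dart_flow_def)
qed

text \<open>The face on the right of \<open>e\<close> is also on the left of \<open>prv H e\<close>,
  so the values added and subtracted around a vertex are the same up to a cyclic shift.\<close>

lemma sum_boundary_tail:
  fixes K :: "'d \<Rightarrow> int"
  assumes K: "face_potential K" and d: "d \<in> darts H"
  shows "(\<Sum>e\<in>tail H d. K e - K (opp H e)) = 0"
proof -
  have "(\<Sum>e\<in>tail H d. K (opp H e)) = (\<Sum>e\<in>tail H d. K (prv H e))"
  proof (rule sum.cong)
    fix e assume "e \<in> tail H d"
    then have "e \<in> darts H" using tail_subset d by blast
    then show "K (opp H e) = K (prv H e)"
      using K by (auto simp: face_potential_def face_nxt_def opp_opp dest!: bspec[of _ _ "opp H e"])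
  qed simp
  also have "\<dots> = (\<Sum>e\<in>tail H d. K (prv H (nxt H e)))"
    unfolding tail_def
    by (rule sum_orbit_shift[OF nxt_permutes finite_darts, symmetric, of "\<lambda>e. K (prv H e)"])
  finally show ?thesis by (simp add: sum_subtractf)
qed

section \<open>Degrees and conservation\<close>

lemma card_tail:
  assumes "T \<subseteq> darts H"
  shows "int (outdeg H T (tail H d)) = (\<Sum>e\<in>tail H d. of_bool (e \<in> T))"
proof -
  have "{e \<in> T. tail H e = tail H d} = T \<inter> tail H d" using tail_eq_iff by auto
  then show ?thesis
    unfolding outdeg_def
    using sum.inter_restrict[OF finite_tail, of "\<lambda>_. 1::int" d T] by (simp add: Int_commute of_bool_def)
qed

lemma card_head:
  assumes T: "T \<subseteq> darts H" and d: "d \<in> darts H"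
  shows "int (indeg H T (tail H d)) = (\<Sum>e\<in>tail H d. of_bool (opp H e \<in> T))"
proof -
  have "bij_betw (opp H) {e \<in> tail H d. opp H e \<in> T} {e \<in> T. head H e = tail H d}"
    using T tail_subset[OF d]
    by (intro bij_betwI[where g = "opp H"]) (auto simp: head_def tail_eq_iff opp_opp subset_eq)
  then have "indeg H T (tail H d) = card {e \<in> tail H d. opp H e \<in> T}"
    unfolding indeg_def by (simp add: bij_betw_same_card)
  also have "int \<dots> = (\<Sum>e\<in>tail H d. of_bool (opp H e \<in> T))"
    using sum.inter_filter[OF finite_tail, of "\<lambda>_. 1::int" d "\<lambda>e. opp H e \<in> T"]
    by (simp add: of_bool_def)
  finally show ?thesis .
qed

definition conserved :: "('d \<Rightarrow> int) \<Rightarrow> bool" where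
  "conserved f \<longleftrightarrow> (\<forall>d\<in>darts H. (\<Sum>e\<in>tail H d. f e) = 0)"

lemma eulerian_iff:
  assumes "T \<subseteq> darts H"
  shows "eulerian H T \<longleftrightarrow> conserved (dart_flow H T)"
proof -
  have "outdeg H T (tail H d) = indeg H T (tail H d) \<longleftrightarrow> (\<Sum>e\<in>tail H d. dart_flow H T e) = 0"
    if "d \<in> darts H" for d
    using card_tail[OF assms, of d] card_head[OF assms that]
    by (simp add: dart_flow_def sum_subtractf flip: of_nat_eq_iff[where 'a=int])
  then show ?thesis by (auto simp: eulerian_def conserved_def vertices_def)
qed

text \<open>Edges on which the orientations agree contribute 0, and on a reversed edge the sign
  records the direction in \<open>D\<close>. This turns conditions on \<open>D\<close> and
  \<open>D'\<close> into linear conditions on the flow of their difference.\<close>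

lemma dart_flow_orientation_diff:
  assumes D: "orientation H D" "orientation H D'" and x: "x \<in> darts H"
  shows "dart_flow H (orientation_diff H D D') x = of_bool (x \<in> D) - of_bool (x \<in> D')"
  using orientation_opp_iff[OF D(1) x] orientation_opp_iff[OF D(2) x] x
  by (auto simp: dart_flow_def orientation_diff_def opp_opp)

lemma same_outdegrees_iff:
  assumes D: "orientation H D" "orientation H D'"
  shows "same_outdegrees H D D' \<longleftrightarrow> conserved (dart_flow H (orientation_diff H D D'))"
proof -
  have s: "D \<subseteq> darts H" "D' \<subseteq> darts H" using D unfolding orientation_def by blast+
  have "outdeg H D (tail H d) = outdeg H D' (tail H d) \<longleftrightarrow>
      (\<Sum>e\<in>tail H d. dart_flow H (orientation_diff H D D') e) = 0" if d: "d \<in> darts H" for d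
  proof -
    have "(\<Sum>e\<in>tail H d. dart_flow H (orientation_diff H D D') e) =
      (\<Sum>e\<in>tail H d. of_bool (e \<in> D) - of_bool (e \<in> D'))"
      using dart_flow_orientation_diff[OF D] tail_subset[OF d] by (intro sum.cong) auto
    then show ?thesis
      using card_tail[OF s(1), of d] card_tail[OF s(2), of d]
      by (simp add: sum_subtractf flip: of_nat_eq_iff[where 'a=int])
  qed
  then show ?thesis by (auto simp: same_outdegrees_def conserved_def vertices_def)
qed

section \<open>Paths and potentials on the vertices\<close>

primrec path :: "'d set \<Rightarrow> 'd list \<Rightarrow> 'd set \<Rightarrow> bool" where
  "path u [] v \<longleftrightarrow> u = v"
| "path u (d # w) v \<longleftrightarrow> d \<in> darts H \<and> tail H d = u \<and> path (head H d) w v"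

lemma path_append: "path u (w @ w') v \<longleftrightarrow> (\<exists>x. path u w x \<and> path x w' v)"
  by (induction w arbitrary: u) auto

lemma path_rev: "path u w v \<Longrightarrow> path v (rev (map (opp H) w)) u"
  by (induction w arbitrary: u) (auto simp: path_append head_def opp_opp)

lemma path_darts: "path u w v \<Longrightarrow> set w \<subseteq> darts H"
  by (induction w arbitrary: u) auto

lemma path_ends: "path u w v \<Longrightarrow> w \<noteq> [] \<Longrightarrow> tail H (hd w) = u \<and> head H (last w) = v"
  by (induction w arbitrary: u) auto

lemma path_consecutive: "path u w v \<Longrightarrow> Suc i < length w \<Longrightarrow> head H (w ! i) = tail H (w ! Suc i)"
proof (induction w arbitrary: u i)
  case (Cons d w)
  then show ?case
    by (cases i) (use path_ends[of "head H d" w v] in \<open>auto simp: hd_conv_nth\<close>)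
qed simp

text \<open>\<open>path\<close> names its end vertices, which makes concatenation compositional.
  When they agree, the last dart leads back to the first, as the cyclic condition of
  \<open>closed_walk\<close> demands.\<close>

lemma closed_walk_if_path:
  assumes p: "path u w u"
  shows "closed_walk H w"
proof -
  have "head H (w ! i) = tail H (w ! (Suc i mod length w))" if i: "i < length w" for i
  proof (cases "Suc i = length w")
    case True
    from i have ne: "w \<noteq> []" by auto
    have "i = length w - 1" using True by linarith
    then have "w ! i = last w" using ne by (simp add: last_conv_nth)
    moreover have "w ! (Suc i mod length w) = hd w" using True ne by (simp add: hd_conv_nth)
    ultimately show ?thesis using path_ends[OF p ne] by simp
  next
    case False
    then show ?thesis using path_consecutive[OF p, of i] i by simp
  qed
  then show ?thesis using path_darts[OF p] by (simp add: closed_walk_def)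
qed

lemma path_exists:
  assumes r: "r \<in> darts H" and e: "e \<in> darts H"
  shows "\<exists>w. path (tail H r) w (tail H e)"
proof -
  from connected[OF r e] have "e \<in> darts H \<and> (\<exists>w. path (tail H r) w (tail H e))"
  proof induction
    case base
    show ?case using r by (auto intro: exI[of _ "[]"])
  next
    case (step y z)
    then obtain w where w: "path (tail H r) w (tail H y)" and y: "y \<in> darts H" by blast
    \<comment> \<open>This serves an \<open>opp\<close> step, which moves to the other end of
      \<open>y\<close>. A \<open>nxt\<close> step stays at the same vertex, where \<open>w\<close>
      already ends.\<close>
    have "path (tail H r) (w @ [y]) (head H y)" using w y by (auto simp: path_append)
    then show ?case using step(2) w y by (auto simp: head_def tail_nxt)
  qed
  then show ?thesis by simp
qed

text \<open>The potential of a vertex is the sum of \<open>f\<close> along a chosen path from a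
  fixed root. Going to the tail of \<open>d\<close>, along \<open>d\<close>, and back from its head
  to the root is a closed walk, whose vanishing sum gives the increment along
  \<open>d\<close>.\<close>

lemma potential_if_closed_walk_sums_zero:
  fixes f :: "'d \<Rightarrow> int"
  assumes anti: "\<And>d. d \<in> darts H \<Longrightarrow> f (opp H d) = - f d"
    and zero: "\<And>w. closed_walk H w \<Longrightarrow> sum_list (map f w) = 0"
  obtains q where "\<And>d. d \<in> darts H \<Longrightarrow> f d = q (head H d) - q (tail H d)"
proof (cases "darts H = {}")
  case True
  then show thesis using that by simp
next
  case False
  then obtain r where r: "r \<in> darts H" by blast
  define W where "W v = (SOME w. path (tail H r) w v)" for v
  have W: "path (tail H r) (W (tail H e)) (tail H e)" if "e \<in> darts H" for e
    unfolding W_def by (rule someI_ex[OF path_exists[OF r that]])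
  have sum_rev: "sum_list (map f (rev (map (opp H) w))) = - sum_list (map f w)"
    if "set w \<subseteq> darts H" for w
    using that by (induction w) (auto simp: anti)
  show thesis
  proof (rule that[of "\<lambda>v. sum_list (map f (W v))"])
    fix d assume d: "d \<in> darts H"
    have h: "path (tail H r) (W (head H d)) (head H d)"
      unfolding head_def by (rule W) (simp add: d)
    have "path (tail H r) (W (tail H d) @ [d] @ rev (map (opp H) (W (head H d)))) (tail H r)"
      using W[OF d] path_rev[OF h] d by (auto simp: path_append)
    from zero[OF closed_walk_if_path[OF this]]
    show "f d = sum_list (map f (W (head H d))) - sum_list (map f (W (tail H d)))"
      using sum_rev[OF path_darts[OF h]] by simp
  qed
qed

text \<open>Passing to the opposite dart changes the sign of both factors, so a dart of the walk
  contributes its own value of \<open>f\<close> whether or not it lies in \<open>R\<close>.\<close>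

lemma sum_walk_flow:
  fixes f :: "'d \<Rightarrow> int"
  assumes R: "orientation H R"
    and anti: "\<And>d. d \<in> darts H \<Longrightarrow> f (opp H d) = - f d"
  shows "set w \<subseteq> darts H \<Longrightarrow> (\<Sum>e\<in>R. f e * walk_flow H R w e) = sum_list (map f w)"
proof (induction w)
  case Nil
  then show ?case by (simp add: walk_flow_def)
next
  case (Cons d w)
  then have d: "d \<in> darts H" by simp
  have RD: "R \<subseteq> darts H" and ori: "d \<in> R \<longleftrightarrow> opp H d \<notin> R"
    using R orientation_opp_iff[OF R d] unfolding orientation_def by blast+
  have finR: "finite R" using finite_subset[OF RD finite_darts] .
  have "(\<Sum>e\<in>R. f e * walk_flow H R (d # w) e) =
    (\<Sum>e\<in>R. f e * walk_flow H R w e + ((if e = d then f e else 0) - (if e = opp H d then f e else 0)))"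
  proof (rule sum.cong)
    fix e assume e: "e \<in> R"
    then have "d = opp H e \<longleftrightarrow> e = opp H d" using RD d opp_opp by auto
    then show "f e * walk_flow H R (d # w) e =
      f e * walk_flow H R w e + ((if e = d then f e else 0) - (if e = opp H d then f e else 0))"
      using e by (auto simp: walk_flow_def algebra_simps)
  qed simp
  also have "\<dots> = sum_list (map f w) + ((if d \<in> R then f d else 0) - (if opp H d \<in> R then f (opp H d) else 0))"
    using Cons finR by (simp add: sum.distrib sum_subtractf)
  also have "\<dots> = sum_list (map f (d # w))" using ori anti[OF d] by auto
  finally show ?case .
qed

text \<open>The sum along a walk is a linear functional \<open>L\<close> of its flow. It vanishes on
  facial walks and on the basis, and the flow of every closed walk lies in the group that these
  generate.\<close>

lemma closed_walk_sum_zero_if_basis: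
  fixes f :: "'d \<Rightarrow> int"
  assumes R: "orientation H R" and basis: "homology_basis H R Bs"
    and anti: "\<And>d. d \<in> darts H \<Longrightarrow> f (opp H d) = - f d"
    and face: "\<And>d. d \<in> darts H \<Longrightarrow> (\<Sum>e\<in>orbit (face_nxt H) d. f e) = 0"
    and Bs: "\<And>B. B \<in> set Bs \<Longrightarrow> sum_list (map f B) = 0"
    and w: "closed_walk H w"
  shows "sum_list (map f w) = 0"
proof -
  define L where "L x = (\<Sum>e\<in>R. f e * x e)" for x :: "'d \<Rightarrow> int"
  have L_diff: "L (x - y) = L x - L y" for x y
    by (simp add: L_def algebra_simps sum_subtractf)
  have L_walk: "L (walk_flow H R w) = sum_list (map f w)" if "set w \<subseteq> darts H" for w
    unfolding L_def using R anti that by (rule sum_walk_flow)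
  have L_zero: "L x = 0" if "x \<in> group_closure S" "\<And>s. s \<in> S \<Longrightarrow> L s = 0" for x S
    using that(1)
  proof induction
    case (base s)
    then show ?case using that(2) by (auto simp: L_def)
  next
    case (diff s t)
    then show ?case unfolding L_diff by simp
  qed
  have L_face: "L x = 0" if "x \<in> face_flows H R" for x
    using that unfolding face_flows_def
  proof (rule L_zero)
    fix s assume "s \<in> (\<lambda>d. walk_flow H R (facial_walk H d)) ` darts H"
    then obtain d where d: "d \<in> darts H" "s = walk_flow H R (facial_walk H d)" by blast
    have "set (facial_walk H d) \<subseteq> darts H"
      unfolding set_facial_walk by (rule permutes_orbit_subset[OF face_nxt_permutes d(1)])
    then have "L s = sum_list (map f (facial_walk H d))" by (simp add: d(2) L_walk)
    also have "\<dots> = 0"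
      using face[OF d(1)] by (simp add: sum_list_distinct_conv_sum_set distinct_facial_walk set_facial_walk)
    finally show "L s = 0" .
  qed
  have Bs_closed: "closed_walk H B" if "B \<in> set Bs" for B
    using basis that by (simp add: homology_basis_def)
  have "walk_flow H R w \<in> closed_walk_flows H R"
    unfolding closed_walk_flows_def using w by (intro group_closure.base) auto
  then obtain y where y: "y \<in> group_closure (walk_flow H R ` set Bs)"
    and hom: "homologous H R (walk_flow H R w) y"
    using basis by (auto simp: homology_basis_def)
  have "L y = 0"
    using y
  proof (rule L_zero)
    fix s assume "s \<in> walk_flow H R ` set Bs"
    then show "L s = 0" using L_walk Bs Bs_closed by (auto simp: closed_walk_def)
  qed
  moreover have "L (walk_flow H R w - y) = 0" using L_face hom by (simp add: homologous_def)
  ultimately have "L (walk_flow H R w) = 0" using L_diff[of "walk_flow H R w" y] by linarith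
  then show ?thesis using L_walk w by (simp add: closed_walk_def)
qed

section \<open>Sectors between two darts at a vertex\<close>

lemma ccw_between_eq_image:
  assumes b: "b \<in> tail H a" and ab: "a \<noteq> b"
  shows "{e. ccw_between H a b e} = (\<lambda>k. (nxt H ^^ k) a) ` {1..<funpow_dist (nxt H) a b}"
    (is "?l = ?r")
proof
  let ?N = "funpow_dist (nxt H) a b"
  have N: "(nxt H ^^ ?N) a = b" using funpow_dist_prop b by (simp add: tail_def)
  \<comment> \<open>Here \<open>a \<noteq> b\<close> matters: between \<open>a\<close> and itself
    lie all other darts at the vertex, whereas \<open>funpow_dist\<close> would be 0.\<close>
  then have N0: "?N \<ge> 1" using ab by (cases ?N) auto
  show "?l \<subseteq> ?r"
  proof
    fix e assume "e \<in> ?l"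
    then obtain k where k: "k \<ge> 1" "e = (nxt H ^^ k) a" "\<forall>j\<in>{1..k}. (nxt H ^^ j) a \<noteq> b"
      by (auto simp: ccw_between_def)
    then have "?N \<notin> {1..k}" using N by blast
    then show "e \<in> ?r" using k N0 by auto
  qed
  show "?r \<subseteq> ?l"
  proof
    fix e assume "e \<in> ?r"
    then obtain k where k: "1 \<le> k" "k < ?N" "e = (nxt H ^^ k) a" by auto
    then have "(nxt H ^^ j) a \<noteq> b" if "j \<in> {1..k}" for j
      using that by (intro funpow_dist_least) auto
    then show "e \<in> ?l" unfolding ccw_between_def using k(1,3) by blast
  qed
qed

text \<open>The sum telescopes from \<open>a\<close> to the last dart before \<open>b\<close>, which
  is \<open>prv H b\<close>. If \<open>b\<close> directly follows \<open>a\<close>, the sector is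
  empty and both sides are 0.\<close>

lemma ccw_between_sum:
  fixes p :: "'d \<Rightarrow> int"
  assumes b: "b \<in> tail H a" and ab: "a \<noteq> b"
  shows "(\<Sum>e\<in>{e. ccw_between H a b e}. p e - p (prv H e)) = p (prv H b) - p a"
proof -
  define N where "N = funpow_dist (nxt H) a b"
  have N: "(nxt H ^^ N) a = b" using funpow_dist_prop b by (simp add: tail_def N_def)
  then obtain M where M: "N = Suc M" using ab by (cases N) auto
  have inj: "inj_on (\<lambda>k. (nxt H ^^ k) a) {1..<N}"
    by (rule inj_on_subset[OF inj_on_funpow_dist[OF b[unfolded tail_def]]]) (auto simp: N_def)
  have tele: "(\<Sum>k\<in>{1..<Suc m}. p ((nxt H ^^ k) a) - p (prv H ((nxt H ^^ k) a))) =
    p ((nxt H ^^ m) a) - p a" for m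
    by (induction m) auto
  have "(nxt H ^^ M) a = prv H b" using N M nxt_prv(2)[of "(nxt H ^^ M) a"] by simp
  then show ?thesis
    unfolding ccw_between_eq_image[OF b ab] N_def[symmetric] sum.reindex[OF inj]
    using tele[of M] by (simp add: M del: sum.op_ivl_Suc)
qed

lemma ccw_betweenD:
  assumes b: "b \<in> tail H a" and ab: "a \<noteq> b" and e: "ccw_between H a b e"
  shows "e \<in> tail H a" "e \<noteq> a" "e \<noteq> b"
proof -
  let ?N = "funpow_dist (nxt H) a b"
  obtain k where k: "1 \<le> k" "k < ?N" "e = (nxt H ^^ k) a"
    using equalityD1[OF ccw_between_eq_image[OF b ab]] e by fastforce
  show "e \<in> tail H a" using k by (auto simp: tail_def orbit_altdef)
  have o: "b \<in> orbit (nxt H) a" using b by (simp add: tail_def)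
  show "e \<noteq> a"
    using funpow_neq_less_funpow_dist[OF o, of k 0] k by simp
  show "e \<noteq> b" using funpow_dist_least[of k "nxt H" a b] k by simp
qed

lemma finite_ccw_between:
  assumes "b \<in> tail H a" "a \<noteq> b"
  shows "finite {e. ccw_between H a b e}"
  unfolding ccw_between_eq_image[OF assms] by simp

section \<open>Flows on the primal-dual completion\<close>

interpretation pd: comb_map "pd_completion H"
  by unfold_locales (rule combinatorial_map_pd_completion[OF comb_map])

lemma pd_mem [simp]:
  "V2E d \<in> pd_darts H \<longleftrightarrow> d \<in> darts H" "E2V d \<in> pd_darts H \<longleftrightarrow> d \<in> darts H"
  "F2E d \<in> pd_darts H \<longleftrightarrow> d \<in> darts H" "E2F d \<in> pd_darts H \<longleftrightarrow> d \<in> darts H"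
  by (auto simp: pd_darts_def)

lemma pd_opp_simps:
  assumes "d \<in> darts H"
  shows "opp (pd_completion H) (V2E d) = E2V d" "opp (pd_completion H) (E2V d) = V2E d"
    "opp (pd_completion H) (F2E d) = E2F d" "opp (pd_completion H) (E2F d) = F2E d"
  using assms by (simp_all add: pd_completion_simps perm_restrict_def)

lemma pd_nxt_simps:
  assumes "d \<in> darts H"
  shows "nxt (pd_completion H) (V2E d) = V2E (nxt H d)"
    "nxt (pd_completion H) (E2V d) = E2F (opp H d)"
    "nxt (pd_completion H) (F2E d) = F2E (face_nxt H d)"
    "nxt (pd_completion H) (E2F d) = E2V d"
  using assms by (simp_all add: pd_completion_simps perm_restrict_def)

text \<open>Together these rules trace the quadrilateral \<open>V2E d\<close>, \<open>E2F d\<close>,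
  \<open>F2E (opp H (nxt H d))\<close>, \<open>E2V (nxt H d)\<close>, which is the angle between
  \<open>d\<close> and \<open>nxt H d\<close>.\<close>

lemma pd_face_nxt_simps:
  assumes d: "d \<in> darts H"
  shows "face_nxt (pd_completion H) (V2E d) = E2F d"
    "face_nxt (pd_completion H) (E2V d) = V2E (prv H d)"
    "face_nxt (pd_completion H) (F2E d) = E2V (opp H d)"
    "face_nxt (pd_completion H) (E2F d) = F2E (opp H (nxt H d))"
proof -
  have key: "face_nxt (pd_completion H) x = y"
    if "nxt (pd_completion H) y = opp (pd_completion H) x" for x y
    unfolding face_nxt_def[of "pd_completion H"] using that pd.nxt_prv(2)[of y] by simp
  show "face_nxt (pd_completion H) (V2E d) = E2F d"
    "face_nxt (pd_completion H) (E2V d) = V2E (prv H d)"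
    "face_nxt (pd_completion H) (F2E d) = E2V (opp H d)"
    "face_nxt (pd_completion H) (E2F d) = F2E (opp H (nxt H d))"
    by (rule key; use d in \<open>simp add: pd_nxt_simps pd_opp_simps opp_opp face_nxt_def\<close>)+
qed

text \<open>Each quadrilateral contains exactly one dart of the form \<open>V2E d\<close>, which
  represents the angle \<open>d\<close>.\<close>

lemma pd_potential_angle:
  assumes K: "pd.face_potential K" and x: "x \<in> pd_darts H"
  shows "K x = K (V2E (pd_angle H x))"
proof -
  have K': "K (face_nxt (pd_completion H) y) = K y" if "y \<in> pd_darts H" for y
    using K that by (simp add: pd.face_potential_def pd_completion_simps)
  have e: "K (E2V d) = K (V2E (prv H d))" if "d \<in> darts H" for d
    using K'[of "E2V d"] that by (simp add: pd_face_nxt_simps)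
  show ?thesis
  proof (cases x)
    case (E2V d) then show ?thesis using e x by simp
  next
    case (F2E d) then show ?thesis using K'[of "F2E d"] e[of "opp H d"] x by (simp add: pd_face_nxt_simps)
  next
    case (E2F d) then show ?thesis using K'[of "V2E d"] x by (simp add: pd_face_nxt_simps)
  qed simp
qed

text \<open>
  The faces of the completion are the angles, so \<open>k\<close> below is a function on the faces; the two
  equations say that \<open>f\<close> is its coboundary.
\<close>

definition pd_exact :: "('d pd_dart \<Rightarrow> 'b::ab_group_add) \<Rightarrow> bool" where
  "pd_exact f \<longleftrightarrow> (\<exists>k. \<forall>d\<in>darts H. f (V2E d) = k d - k (prv H d) \<and> f (F2E d) = k (face_nxt H d) - k d)"

lemma pd_exactI:
  assumes "\<And>d. d \<in> darts H \<Longrightarrow> f (V2E d) = k d - k (prv H d)"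
    and "\<And>d. d \<in> darts H \<Longrightarrow> f (F2E d) = k (face_nxt H d) - k d"
  shows "pd_exact f"
  unfolding pd_exact_def using assms by blast

lemma pd_exact_cong:
  assumes "\<And>d. d \<in> darts H \<Longrightarrow> f (V2E d) = g (V2E d)" "\<And>d. d \<in> darts H \<Longrightarrow> f (F2E d) = g (F2E d)"
  shows "pd_exact f \<longleftrightarrow> pd_exact g"
  using assms by (simp add: pd_exact_def)

lemma pd_exact_diff:
  assumes "pd_exact f" "pd_exact g"
  shows "pd_exact (\<lambda>x. f x - g x)"
proof -
  obtain k where k: "\<And>d. d \<in> darts H \<Longrightarrow> f (V2E d) = k d - k (prv H d)"
    "\<And>d. d \<in> darts H \<Longrightarrow> f (F2E d) = k (face_nxt H d) - k d"
    using assms(1) unfolding pd_exact_def by blast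
  obtain l where l: "\<And>d. d \<in> darts H \<Longrightarrow> g (V2E d) = l d - l (prv H d)"
    "\<And>d. d \<in> darts H \<Longrightarrow> g (F2E d) = l (face_nxt H d) - l d"
    using assms(2) unfolding pd_exact_def by blast
  show ?thesis
    by (rule pd_exactI[of _ "\<lambda>d. k d - l d"]) (simp_all add: k l algebra_simps)
qed

lemma pd_exact_uminus: "pd_exact f \<Longrightarrow> pd_exact (\<lambda>x. - f x)"
  using pd_exact_diff[of "\<lambda>_. 0" f] pd_exactI[of "\<lambda>_. 0" "\<lambda>_. 0"] by simp

lemma pd_exact_add:
  assumes "pd_exact f" "pd_exact g"
  shows "pd_exact (\<lambda>x. f x + g x)"
  using pd_exact_diff[OF assms(1) pd_exact_uminus[OF assms(2)]] by simp

text \<open>With target type \<open>3\<close> this is reduction modulo 3: an integer potential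
  yields one modulo 3.\<close>

lemma pd_exact_of_int:
  assumes "pd_exact f"
  shows "pd_exact (\<lambda>x. of_int (f x) :: 'b::ring_1)"
proof -
  obtain k where k: "\<And>d. d \<in> darts H \<Longrightarrow> f (V2E d) = k d - k (prv H d)"
    "\<And>d. d \<in> darts H \<Longrightarrow> f (F2E d) = k (face_nxt H d) - k d"
    using assms unfolding pd_exact_def by blast
  show ?thesis by (rule pd_exactI[of _ "\<lambda>d. of_int (k d)"]) (simp_all add: k)
qed

text \<open>Face potentials of the completion correspond to functions on angles through
  \<open>pd_angle\<close>. The angles to the left and right of \<open>V2E d\<close> are
  \<open>d\<close> and \<open>prv H d\<close>, those of \<open>F2E d\<close> are
  \<open>face_nxt H d\<close> and \<open>d\<close>, and antisymmetry covers the opposite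
  darts.\<close>

lemma ex_face_potential_iff:
  fixes f :: "'d pd_dart \<Rightarrow> int"
  assumes anti: "\<And>x. x \<in> pd_darts H \<Longrightarrow> f (opp (pd_completion H) x) = - f x"
  shows "(\<exists>K. pd.face_potential K \<and>
      (\<forall>e\<in>darts (pd_completion H). f e = K e - K (opp (pd_completion H) e))) \<longleftrightarrow> pd_exact f"
proof
  assume "\<exists>K. pd.face_potential K \<and>
      (\<forall>e\<in>darts (pd_completion H). f e = K e - K (opp (pd_completion H) e))"
  then obtain K where K: "pd.face_potential K"
    and f: "\<And>e. e \<in> pd_darts H \<Longrightarrow> f e = K e - K (opp (pd_completion H) e)"
    by (auto simp: pd_completion_simps(1))
  show "pd_exact f"
  proof (rule pd_exactI)
    fix d assume d: "d \<in> darts H"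
    show "f (V2E d) = K (V2E d) - K (V2E (prv H d))"
      using f[of "V2E d"] pd_potential_angle[OF K, of "E2V d"] d by (simp add: pd_opp_simps)
    show "f (F2E d) = K (V2E (face_nxt H d)) - K (V2E d)"
      using f[of "F2E d"] pd_potential_angle[OF K, of "E2F d"] pd_potential_angle[OF K, of "F2E d"] d
      by (simp add: pd_opp_simps face_nxt_def)
  qed
next
  assume "pd_exact f"
  then obtain k where k: "\<And>d. d \<in> darts H \<Longrightarrow> f (V2E d) = k d - k (prv H d)"
    "\<And>d. d \<in> darts H \<Longrightarrow> f (F2E d) = k (face_nxt H d) - k d"
    unfolding pd_exact_def by blast
  have "pd.face_potential (\<lambda>x. k (pd_angle H x))"
    unfolding pd.face_potential_def using pd_angle_face_nxt[OF comb_map] by simp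
  moreover have "f x = k (pd_angle H x) - k (pd_angle H (opp (pd_completion H) x))"
    if x: "x \<in> pd_darts H" for x
    using x k anti[of "V2E _"] anti[of "F2E _"]
    by (cases x) (simp_all add: pd_opp_simps face_nxt_def)
  ultimately show "\<exists>K. pd.face_potential K \<and>
      (\<forall>e\<in>darts (pd_completion H). f e = K e - K (opp (pd_completion H) e))"
    by (intro exI[of _ "\<lambda>x. k (pd_angle H x)"]) (simp add: pd_completion_simps(1))
qed

lemma dart_flow_pd_opp:
  "x \<in> pd_darts H \<Longrightarrow>
    dart_flow (pd_completion H) T (opp (pd_completion H) x) = - dart_flow (pd_completion H) T x"
  using pd.opp_opp[of x] by (simp add: dart_flow_def pd_completion_simps(1))

lemma pd_homologous_iff:
  assumes R: "orientation (pd_completion H) R"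
  shows "homologous (pd_completion H) R (subgraph_flow (pd_completion H) R P)
      (subgraph_flow (pd_completion H) R Q) \<longleftrightarrow>
    pd_exact (\<lambda>x. dart_flow (pd_completion H) P x - dart_flow (pd_completion H) Q x)"
  unfolding pd.homologous_iff[OF R]
  by (rule ex_face_potential_iff) (simp add: dart_flow_pd_opp)

lemma pd_zero_homologous_iff:
  assumes R: "orientation (pd_completion H) R"
  shows "zero_homologous (pd_completion H) R T \<longleftrightarrow> pd_exact (dart_flow (pd_completion H) T)"
  unfolding pd.zero_homologous_iff[OF R]
  by (rule ex_face_potential_iff) (simp add: dart_flow_pd_opp)

lemma pd_exact_conserved:
  fixes f :: "'d pd_dart \<Rightarrow> int"
  assumes anti: "\<And>x. x \<in> pd_darts H \<Longrightarrow> f (opp (pd_completion H) x) = - f x"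
    and exact: "pd_exact f"
  shows "pd.conserved f"
proof -
  obtain K where K: "pd.face_potential K"
    and f: "\<And>e. e \<in> darts (pd_completion H) \<Longrightarrow> f e = K e - K (opp (pd_completion H) e)"
    using ex_face_potential_iff[of f, OF anti] exact by blast
  show ?thesis unfolding pd.conserved_def
  proof
    fix d assume d: "d \<in> darts (pd_completion H)"
    have "(\<Sum>e\<in>tail (pd_completion H) d. f e) =
      (\<Sum>e\<in>tail (pd_completion H) d. K e - K (opp (pd_completion H) e))"
      using pd.tail_subset[OF d] by (intro sum.cong) (auto intro: f)
    then show "(\<Sum>e\<in>tail (pd_completion H) d. f e) = 0"
      using pd.sum_boundary_tail[OF K d] by simp
  qed
qed

section \<open>Schnyder orientations as exactness modulo 3\<close>

lemma EDGE_labeling_iff: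
  "EDGE_labeling H l \<longleftrightarrow>
    (\<forall>d\<in>darts H. l d - l (prv H d) \<in> {0, 1} \<and> l (face_nxt H d) - l d \<in> {0, 1})"
proof -
  have "edge_type0 H l d \<or> edge_type1 H l d \<or> edge_type2 H l d \<longleftrightarrow>
    l d - l (prv H d) \<in> {0, 1} \<and> l (face_nxt H d) - l d \<in> {0, 1} \<and>
    l (opp H d) - l (prv H (opp H d)) \<in> {0, 1} \<and> l (face_nxt H (opp H d)) - l (opp H d) \<in> {0, 1}"
    if "d \<in> darts H" for d
    using edge_labels_iff[of "l d" "l (prv H (opp H d))" "l (opp H d)" "l (prv H d)"]
    by (simp add: edge_type0_def edge_type1_def edge_type2_def face_nxt_def opp_opp[OF that])
  \<comment> \<open>Two of the four differences around an edge belong to \<open>d\<close> and two to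
    \<open>opp H d\<close>. As \<open>opp H\<close> preserves the darts, asking for two at every
    dart covers all four.\<close>
  then show ?thesis unfolding EDGE_labeling_def using in_darts(1) by blast
qed

text \<open>An edge enters its edge-vertex iff the labels on its two sides differ, and in an EDGE
  labeling the label rises by 0 or 1 from the right of \<open>V2E d\<close> or \<open>F2E d\<close>
  to its left. So the rise is the indicator of \<open>D\<close> at that dart.\<close>

lemma schnyder_orientation_iff:
  assumes D: "orientation (pd_completion H) D"
  shows "schnyder_orientation H D \<longleftrightarrow> pd_exact (\<lambda>x. of_bool (x \<in> D) :: 3)"
proof -
  have ori: "V2E d \<in> D \<longleftrightarrow> E2V d \<notin> D" "F2E d \<in> D \<longleftrightarrow> E2F d \<notin> D" if "d \<in> darts H" for d
    using pd.orientation_opp_iff[OF D, of "E2V d"] pd.orientation_opp_iff[OF D, of "E2F d"] that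
    by (simp_all add: pd_completion_simps(1) pd_opp_simps)
  have out: "(\<forall>x\<in>darts (pd_completion H). from_edge_vertex x \<longrightarrow>
         (x \<in> D \<longleftrightarrow> l (pd_angle H x) = l (pd_angle H (opp (pd_completion H) x)))) \<longleftrightarrow>
    (\<forall>d\<in>darts H. (V2E d \<in> D \<longleftrightarrow> l d \<noteq> l (prv H d)) \<and> (F2E d \<in> D \<longleftrightarrow> l (face_nxt H d) \<noteq> l d))"
    (is "?l \<longleftrightarrow> ?r") for l :: "'d \<Rightarrow> 3"
  proof
    assume l: ?l
    show ?r
    proof
      fix d assume "d \<in> darts H"
      then show "(V2E d \<in> D \<longleftrightarrow> l d \<noteq> l (prv H d)) \<and> (F2E d \<in> D \<longleftrightarrow> l (face_nxt H d) \<noteq> l d)"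
        using l[rule_format, of "E2V d"] l[rule_format, of "E2F d"]
        by (auto simp: ori pd_opp_simps pd_completion_simps(1) face_nxt_def)
    qed
  next
    assume r: ?r
    show ?l
    proof (intro ballI impI)
      fix x assume x: "x \<in> darts (pd_completion H)" "from_edge_vertex x"
      then show "x \<in> D \<longleftrightarrow> l (pd_angle H x) = l (pd_angle H (opp (pd_completion H) x))"
        by (cases x)
          (use r ori in \<open>auto simp: pd_opp_simps pd_completion_simps(1) face_nxt_def\<close>)
    qed
  qed
  \<comment> \<open>As 1 is nonzero modulo 3, a difference known to be 0 or 1 is determined by
    whether it vanishes. This merges the labeling condition and the orientation condition into one
    equation.\<close>
  have z: "(a - b \<in> {0, 1}) \<and> (P \<longleftrightarrow> a \<noteq> b) \<longleftrightarrow> of_bool P = a - b" for a b :: 3 and P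
    by (auto simp: of_bool_def)
  have "EDGE_labeling H l \<and> (\<forall>x\<in>darts (pd_completion H). from_edge_vertex x \<longrightarrow>
         (x \<in> D \<longleftrightarrow> l (pd_angle H x) = l (pd_angle H (opp (pd_completion H) x)))) \<longleftrightarrow>
    (\<forall>d\<in>darts H. of_bool (V2E d \<in> D) = l d - l (prv H d) \<and>
      of_bool (F2E d \<in> D) = l (face_nxt H d) - l d)" for l
    unfolding out EDGE_labeling_iff z[symmetric] by blast
  then show ?thesis by (simp add: schnyder_orientation_def pd_exact_def D)
qed

text \<open>Exact functions are closed under differences and the indicator of \<open>D\<close> is
  exact, so the indicator of \<open>D'\<close> is exact iff its difference from that of
  \<open>D\<close> is.\<close>

lemma schnyder_orientation_iff_diff_exact:
  assumes D: "orientation (pd_completion H) D" "orientation (pd_completion H) D'"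
    and S: "schnyder_orientation H D"
  shows "schnyder_orientation H D' \<longleftrightarrow>
    pd_exact (\<lambda>x. of_int (dart_flow (pd_completion H) (orientation_diff (pd_completion H) D D') x) :: 3)"
    (is "_ \<longleftrightarrow> pd_exact ?f")
proof -
  let ?b = "\<lambda>D x. of_bool (x \<in> D) :: 3"
  have f: "?f x = ?b D x - ?b D' x" if "x \<in> pd_darts H" for x
    using pd.dart_flow_orientation_diff[OF D] that by (simp add: pd_completion_simps(1))
  have SD: "pd_exact (?b D)" using S schnyder_orientation_iff[OF D(1)] by simp
  show ?thesis unfolding schnyder_orientation_iff[OF D(2)]
  proof
    assume "pd_exact (?b D')"
    then have "pd_exact (\<lambda>x. ?b D x - ?b D' x)" by (rule pd_exact_diff[OF SD])
    then show "pd_exact ?f" by (rule pd_exact_cong[THEN iffD1, rotated -1]) (simp_all add: f)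
  next
    assume "pd_exact ?f"
    then have "pd_exact (\<lambda>x. ?b D x - ?f x)" by (rule pd_exact_diff[OF SD])
    then show "pd_exact (?b D')" by (rule pd_exact_cong[THEN iffD1, rotated -1]) (simp_all add: f)
  qed
qed

section \<open>Partitions and exactness modulo 3\<close>

lemma exact_mod_3_if_partition:
  fixes P :: "3 \<Rightarrow> 'd pd_dart set"
  assumes T: "T = (\<Union>i. P i)" "\<forall>i j. i \<noteq> j \<longrightarrow> P i \<inter> P j = {}"
    and hom: "\<And>i j. pd_exact (\<lambda>x. dart_flow (pd_completion H) (P i) x - dart_flow (pd_completion H) (P j) x)"
  shows "pd_exact (\<lambda>x. of_int (dart_flow (pd_completion H) T x) :: 3)"
proof -
  let ?f = "\<lambda>i. dart_flow (pd_completion H) (P i)"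
  have "pd_exact (\<lambda>x. of_int ((?f 1 x - ?f 0 x) + (?f 2 x - ?f 0 x)) :: 3)"
    by (intro pd_exact_of_int pd_exact_add hom)
  moreover have "of_int (dart_flow (pd_completion H) T x) = (of_int ((?f 1 x - ?f 0 x) + (?f 2 x - ?f 0 x)) :: 3)" for x
  proof -
    \<comment> \<open>The three flows are compared with that of \<open>P 0\<close>: two exact
      differences remain, and the leftover multiple of 3 disappears modulo 3.\<close>
    have "dart_flow (pd_completion H) T x = ((?f 1 x - ?f 0 x) + (?f 2 x - ?f 0 x)) + 3 * ?f 0 x"
      unfolding dart_flow_partition[OF T] by simp
    then have "of_int (dart_flow (pd_completion H) T x) =
      (of_int ((?f 1 x - ?f 0 x) + (?f 2 x - ?f 0 x)) + 3 * of_int (?f 0 x) :: 3)"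
      by (simp only: of_int_add of_int_mult of_int_numeral)
    moreover have "(3 :: 3) = 0" by simp
    ultimately show ?thesis by (simp only: mult_zero_left add_0_right)
  qed
  ultimately show ?thesis by simp
qed

text \<open>
  Walking across \<open>T\<close> from right to left raises the face labels by one; the parts are the edges of
  \<open>T\<close> grouped by the label on their right, and consecutive parts bound the faces of one label.
\<close>

lemma partition_if_exact_mod_3:
  assumes T: "T \<subseteq> pd_darts H" "\<And>x. x \<in> T \<Longrightarrow> opp (pd_completion H) x \<notin> T"
    and exact: "pd_exact (\<lambda>x. of_int (dart_flow (pd_completion H) T x) :: 3)"
  shows "\<exists>P :: 3 \<Rightarrow> 'd pd_dart set. T = (\<Union>i. P i) \<and> (\<forall>i j. i \<noteq> j \<longrightarrow> P i \<inter> P j = {}) \<and>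
    (\<forall>i j. pd_exact (\<lambda>x. dart_flow (pd_completion H) (P i) x - dart_flow (pd_completion H) (P j) x))"
proof -
  let ?o = "opp (pd_completion H)"
  obtain k :: "'d \<Rightarrow> 3" where
    k: "\<And>d. d \<in> darts H \<Longrightarrow> of_int (dart_flow (pd_completion H) T (V2E d)) = k d - k (prv H d)"
      "\<And>d. d \<in> darts H \<Longrightarrow> of_int (dart_flow (pd_completion H) T (F2E d)) = k (face_nxt H d) - k d"
    using exact unfolding pd_exact_def by blast
  define P where "P i = {x \<in> T. k (pd_angle H (?o x)) = i}" for i
  \<comment> \<open>The right side is the jump of the indicator of label \<open>i + 1\<close>.
    Crossing a dart of \<open>P i\<close> from right to left enters that label class, and crossing a
    dart of \<open>P (i + 1)\<close> leaves it.\<close>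
  have step_dart: "dart_flow (pd_completion H) (P i) x - dart_flow (pd_completion H) (P (i + 1)) x =
      of_bool (k (pd_angle H x) = i + 1) - of_bool (k (pd_angle H (?o x)) = i + 1)"
    if x: "x \<in> pd_darts H"
      and kx: "of_int (dart_flow (pd_completion H) T x) = k (pd_angle H x) - k (pd_angle H (?o x))" for i x
  proof -
    have oo: "?o (?o x) = x" using x pd.opp_opp by (simp add: pd_completion_simps(1))
    consider "x \<in> T" "?o x \<notin> T" | "?o x \<in> T" "x \<notin> T" | "x \<notin> T" "?o x \<notin> T"
      using T(2)[of x] by blast
    then show ?thesis
    proof cases
      case 1
      then have "k (pd_angle H x) = k (pd_angle H (?o x)) + 1"
        using kx by (simp add: dart_flow_def algebra_simps)
      then show ?thesis using 1 by (simp add: dart_flow_def P_def)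
    next
      case 2
      then have "k (pd_angle H (?o x)) = k (pd_angle H x) + 1"
        using kx by (simp add: dart_flow_def algebra_simps)
      then show ?thesis using 2 oo by (simp add: dart_flow_def P_def)
    next
      case 3
      then have "k (pd_angle H x) = k (pd_angle H (?o x))"
        using kx by (simp add: dart_flow_def)
      then show ?thesis using 3 by (simp add: dart_flow_def P_def)
    qed
  qed
  let ?E = "\<lambda>i j. pd_exact (\<lambda>x. dart_flow (pd_completion H) (P i) x - dart_flow (pd_completion H) (P j) x)"
  have step: "?E i (i + 1)" for i
  proof (rule pd_exactI)
    fix d assume d: "d \<in> darts H"
    show "dart_flow (pd_completion H) (P i) (V2E d) - dart_flow (pd_completion H) (P (i + 1)) (V2E d) =
      of_bool (k d = i + 1) - of_bool (k (prv H d) = i + 1)"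
      using step_dart[of "V2E d" i] k(1)[OF d] d by (simp add: pd_opp_simps)
    show "dart_flow (pd_completion H) (P i) (F2E d) - dart_flow (pd_completion H) (P (i + 1)) (F2E d) =
      of_bool (k (face_nxt H d) = i + 1) - of_bool (k d = i + 1)"
      using step_dart[of "F2E d" i] k(2)[OF d] d by (simp add: pd_opp_simps face_nxt_def)
  qed
  have "?E i j" for i j
  proof -
    \<comment> \<open>Modulo 3, at most two unit steps lead from \<open>i\<close> to any
      \<open>j\<close>, so chaining \<open>step\<close> compares all parts.\<close>
    have "j = i \<or> j = i + 1 \<or> j = i + 1 + 1" using exhaust_Z3[of "j - i"] by (auto simp: algebra_simps)
    moreover have "?E i i" by (rule pd_exactI[of _ "\<lambda>_. 0"]) simp_all
    moreover have "?E i (i + 1 + 1)" using pd_exact_add[OF step[of i] step[of "i + 1"]] by simp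
    ultimately show ?thesis using step[of i] by blast
  qed
  moreover have "T = (\<Union>i. P i)" "\<forall>i j. i \<noteq> j \<longrightarrow> P i \<inter> P j = {}" by (auto simp: P_def)
  ultimately show ?thesis by blast
qed

text \<open>Homologous flows have the same net outflow at every vertex. That of \<open>T\<close> is
  therefore three times that of any single part, and an integer vanishes iff its triple
  does.\<close>

lemma conserved_partition_iff:
  fixes P :: "3 \<Rightarrow> 'd pd_dart set"
  assumes T: "T = (\<Union>i. P i)" "\<forall>i j. i \<noteq> j \<longrightarrow> P i \<inter> P j = {}"
    and hom: "\<And>i j. pd_exact (\<lambda>x. dart_flow (pd_completion H) (P i) x - dart_flow (pd_completion H) (P j) x)"
  shows "pd.conserved (dart_flow (pd_completion H) T) \<longleftrightarrow>
    (\<forall>i. pd.conserved (dart_flow (pd_completion H) (P i)))"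
proof -
  let ?f = "\<lambda>i. dart_flow (pd_completion H) (P i)"
  have three: "(\<Sum>e\<in>tail (pd_completion H) d. dart_flow (pd_completion H) T e) =
      3 * (\<Sum>e\<in>tail (pd_completion H) d. ?f j e)" if d: "d \<in> darts (pd_completion H)" for d j
  proof -
    have c: "pd.conserved (\<lambda>x. ?f i x - ?f j x)" for i
      by (rule pd_exact_conserved[OF _ hom]) (simp add: dart_flow_pd_opp)
    have eq: "(\<Sum>e\<in>tail (pd_completion H) d. ?f i e) = (\<Sum>e\<in>tail (pd_completion H) d. ?f j e)" for i
      using c[of i] d by (simp add: pd.conserved_def sum_subtractf)
    show ?thesis
      unfolding dart_flow_partition[OF T] sum.distrib using eq[of 0] eq[of 1] eq[of 2] by linarith
  qed
  have "(\<Sum>e\<in>tail (pd_completion H) d. dart_flow (pd_completion H) T e) = 0 \<longleftrightarrow>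
      (\<Sum>e\<in>tail (pd_completion H) d. ?f j e) = 0" if "d \<in> darts (pd_completion H)" for d j
    unfolding three[OF that, of j] by simp
  then show ?thesis unfolding pd.conserved_def by blast
qed

lemma schnyder_iff_partitionable:
  assumes D: "orientation (pd_completion H) D" "orientation (pd_completion H) D'"
    and R: "orientation (pd_completion H) R"
    and S: "schnyder_orientation H D"
    and T: "T = orientation_diff (pd_completion H) D D'"
  shows "schnyder_orientation H D' \<longleftrightarrow> partitionable (pd_completion H) R T" (is ?part1)
    and "schnyder_orientation H D' \<and> same_outdegrees (pd_completion H) D D' \<longleftrightarrow>
      eulerian_partitionable (pd_completion H) R T" (is ?part2)
proof -
  have Tsub: "T \<subseteq> pd_darts H"
    using D(1) unfolding T orientation_diff_def orientation_def pd_completion_simps(1) by blast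
  have Topp: "opp (pd_completion H) x \<notin> T" if "x \<in> T" for x
    using pd.orientation_opp_iff[OF D(1), of x] that Tsub
    by (auto simp: T orientation_diff_def pd_completion_simps(1))
  show part1: ?part1
  proof
    assume "schnyder_orientation H D'"
    then show "partitionable (pd_completion H) R T"
      unfolding schnyder_orientation_iff_diff_exact[OF D S] T[symmetric] partitionable_def
        pd_homologous_iff[OF R]
      using Topp by (intro partition_if_exact_mod_3[OF Tsub])
  next
    assume "partitionable (pd_completion H) R T"
    then obtain P :: "3 \<Rightarrow> 'd pd_dart set" where
      P: "T = (\<Union>i. P i)" "\<forall>i j. i \<noteq> j \<longrightarrow> P i \<inter> P j = {}"
      and "\<forall>i j. pd_exact (\<lambda>x. dart_flow (pd_completion H) (P i) x - dart_flow (pd_completion H) (P j) x)"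
      unfolding partitionable_def pd_homologous_iff[OF R] by blast
    then show "schnyder_orientation H D'"
      unfolding schnyder_orientation_iff_diff_exact[OF D S] T[symmetric]
      by (intro exact_mod_3_if_partition[OF P]) blast
  qed
  \<comment> \<open>For any partition into homologous parts, equality of outdegrees is equivalent to
    all parts being Eulerian. Hence the partition witnessing the first claim also witnesses the
    second.\<close>
  have out: "same_outdegrees (pd_completion H) D D' \<longleftrightarrow> (\<forall>i. eulerian (pd_completion H) (P i))"
    if P: "T = (\<Union>i. P i)" "\<forall>i j. i \<noteq> j \<longrightarrow> P i \<inter> P j = {}"
      "\<And>i j. homologous (pd_completion H) R (subgraph_flow (pd_completion H) R (P i))
        (subgraph_flow (pd_completion H) R (P j))" for P :: "3 \<Rightarrow> 'd pd_dart set"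
  proof -
    have "P i \<subseteq> darts (pd_completion H)" for i
      using P(1) Tsub by (auto simp: pd_completion_simps(1))
    then show ?thesis
      unfolding pd.same_outdegrees_iff[OF D] T[symmetric]
      using conserved_partition_iff[OF P(1,2) P(3)[unfolded pd_homologous_iff[OF R]]]
      by (simp add: pd.eulerian_iff)
  qed
  show ?part2
    unfolding part1 partitionable_def eulerian_partitionable_def using out by blast
qed

section \<open>The type of an orientation as an intersection number\<close>

lemma pd_nxt_funpow_V2E:
  assumes "d \<in> darts H"
  shows "(nxt (pd_completion H) ^^ k) (V2E d) = V2E ((nxt H ^^ k) d)"
proof -
  have "(nxt H ^^ k) d \<in> darts H" for k by (induction k) (simp_all add: assms)
  then show ?thesis by (induction k) (simp_all add: pd_nxt_simps)
qed

lemma ccw_between_pd_vertex: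
  assumes "a \<in> darts H"
  shows "ccw_between (pd_completion H) (V2E a) (V2E b) x \<longleftrightarrow> (\<exists>e. x = V2E e \<and> ccw_between H a b e)"
  unfolding ccw_between_def pd_nxt_funpow_V2E[OF assms] by auto

text \<open>The two halves of an edge are two turns apart at its edge-vertex, so a single dart
  separates them on each side.\<close>

lemma ccw_between_pd_edge:
  assumes d: "d \<in> darts H"
  shows "ccw_between (pd_completion H) (E2V (opp H d)) (E2V d) x \<longleftrightarrow> x = E2F d"
proof -
  let ?n = "nxt (pd_completion H)"
  have n: "?n (E2V (opp H d)) = E2F d" "?n (E2F d) = E2V d"
    using d by (simp_all add: pd_nxt_simps opp_opp)
  show ?thesis
  proof
    assume "ccw_between (pd_completion H) (E2V (opp H d)) (E2V d) x"
    then obtain k where k: "k \<ge> 1" "x = (?n ^^ k) (E2V (opp H d))"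
      "\<forall>j\<in>{1..k}. (?n ^^ j) (E2V (opp H d)) \<noteq> E2V d" by (auto simp: ccw_between_def)
    have "(?n ^^ 2) (E2V (opp H d)) = E2V d" by (simp add: numeral_2_eq_2 n)
    then have "2 \<notin> {1..k}" using k(3) by blast
    then have "k = 1" using k(1) by auto
    then show "x = E2F d" using k(2) n by simp
  next
    assume "x = E2F d"
    then show "ccw_between (pd_completion H) (E2V (opp H d)) (E2V d) x"
      unfolding ccw_between_def by (intro exI[of _ 1]) (auto simp: n)
  qed
qed

lemma ccw_between_pd_edge':
  "d \<in> darts H \<Longrightarrow> ccw_between (pd_completion H) (E2V d) (E2V (opp H d)) x \<longleftrightarrow> x = E2F (opp H d)"
  using ccw_between_pd_edge[of "opp H d"] by (simp add: opp_opp)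

section \<open>Cycles and the two sides of their subdivision\<close>

lemma cycle_nth:
  assumes "cycle H C" and i: "i < length C"
  shows "C ! i \<in> darts H" "C ! (Suc i mod length C) \<in> darts H"
    "opp H (C ! i) \<in> tail H (C ! (Suc i mod length C))"
    "C ! (Suc i mod length C) \<noteq> opp H (C ! i)"
proof -
  have si: "Suc i mod length C < length C" using i by (intro mod_less_divisor) linarith
  have cw: "closed_walk H C" using assms(1) by (simp add: cycle_def)
  show "C ! i \<in> darts H" "C ! (Suc i mod length C) \<in> darts H"
    using cw i si nth_mem by (auto simp: closed_walk_def subset_eq)
  have "head H (C ! i) = tail H (C ! (Suc i mod length C))"
    using cw i by (simp add: closed_walk_def)
  then show "opp H (C ! i) \<in> tail H (C ! (Suc i mod length C))"
    by (simp add: head_def tail_eq_iff)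
  show "C ! (Suc i mod length C) \<noteq> opp H (C ! i)"
    using assms(1) nth_mem[OF i] nth_mem[OF si] unfolding cycle_def by metis
qed

lemma cycle_tail_inj:
  assumes "cycle H C" "i < length C" "j < length C" "tail H (C ! i) = tail H (C ! j)"
  shows "i = j"
proof -
  have "distinct (map (tail H) C)" using assms(1) by (simp add: cycle_def)
  from nth_eq_iff_index_eq[OF this, of i j] show ?thesis using assms by simp
qed

lemma cycle_next_tail_inj:
  assumes C: "cycle H C" and i: "i < length C" and j: "j < length C"
    and eq: "tail H (C ! (Suc i mod length C)) = tail H (C ! (Suc j mod length C))"
  shows "i = j"
proof -
  let ?s = "\<lambda>i. Suc i mod length C"
  note b = bij_betw_Suc_mod[of "length C"]
  have "?s i < length C" "?s j < length C" using bij_betwE[OF b] i j by auto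
  then have "?s i = ?s j" using cycle_tail_inj[OF C _ _ eq] by simp
  then show ?thesis using bij_betw_imp_inj_on[OF b] i j by (auto dest: inj_onD)
qed

text \<open>A cycle visits each vertex at most once, so the only darts at that vertex lying on it,
  in either direction, are the outgoing one and the reversed incoming one.\<close>

lemma not_on_subdivision:
  assumes C: "cycle H C" and i: "i < length C"
    and e: "e \<in> tail H (C ! (Suc i mod length C))" "e \<noteq> C ! (Suc i mod length C)" "e \<noteq> opp H (C ! i)"
  shows "V2E e \<notin> set (subdivision H C)" "opp (pd_completion H) (V2E e) \<notin> set (subdivision H C)"
proof -
  let ?s = "\<lambda>i. Suc i mod length C"
  have si: "?s i < length C" using i by (intro mod_less_divisor) linarith
  have ed: "e \<in> darts H" using tail_subset[OF cycle_nth(2)[OF C i]] e(1) by blast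
  have te: "tail H e = tail H (C ! ?s i)" using tail_eq e(1) by simp
  have "e \<notin> set C"
  proof
    assume "e \<in> set C"
    then obtain j where j: "j < length C" "e = C ! j" by (auto simp: in_set_conv_nth)
    then have "j = ?s i" using cycle_tail_inj[OF C j(1) si] te by simp
    then show False using j e(2) by simp
  qed
  then show "V2E e \<notin> set (subdivision H C)" by (auto simp: set_subdivision)
  have "e \<noteq> opp H d" if d: "d \<in> set C" for d
  proof
    assume eo: "e = opp H d"
    obtain j where j: "j < length C" "d = C ! j" using d by (auto simp: in_set_conv_nth)
    have "tail H (C ! ?s j) = tail H (C ! ?s i)"
      using tail_eq[OF cycle_nth(3)[OF C j(1)]] te eo j(2) by simp
    then have "j = i" using cycle_next_tail_inj[OF C j(1) i] by simp
    then show False using eo j(2) e(3) by simp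
  qed
  then show "opp (pd_completion H) (V2E e) \<notin> set (subdivision H C)"
    using ed by (auto simp: set_subdivision pd_opp_simps)
qed

text \<open>Even positions of the subdivision end at edge-vertices, each with one dart on the left;
  odd positions end at vertices of the cycle and give the sectors there.\<close>

lemma starts_left_subdivision_iff:
  assumes C: "cycle H C"
  shows "starts_left (pd_completion H) (subdivision H C) x \<longleftrightarrow>
    (\<exists>i<length C. x = E2F (C ! i)) \<or>
    (\<exists>i<length C. \<exists>e. x = V2E e \<and> ccw_between H (C ! (Suc i mod length C)) (opp H (C ! i)) e)"
    (is "?l \<longleftrightarrow> ?E \<or> ?V")
proof -
  have "(\<exists>j<length (subdivision H C).
      ccw_between (pd_completion H) (subdivision H C ! (Suc j mod length (subdivision H C)))
        (opp (pd_completion H) (subdivision H C ! j)) x) \<longleftrightarrow> ?E \<or> ?V"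
    unfolding length_subdivision ex_less_double_iff
    using cycle_nth[OF C]
    by (auto simp: Suc_double_mod subdivision_nth subdivision_nth_next pd_opp_simps ccw_between_pd_edge ccw_between_pd_vertex
        cong: conj_cong)
  moreover have "x \<notin> set (subdivision H C) \<and> opp (pd_completion H) x \<notin> set (subdivision H C)"
    if "?E \<or> ?V"
    using that
  proof (elim disjE exE conjE)
    fix i assume "i < length C" "x = E2F (C ! i)"
    then show ?thesis using cycle_nth(1)[OF C] by (auto simp: set_subdivision pd_opp_simps)
  next
    fix i e assume i: "i < length C" and x: "x = V2E e"
      and e: "ccw_between H (C ! (Suc i mod length C)) (opp H (C ! i)) e"
    show ?thesis unfolding x
      using not_on_subdivision[OF C i ccw_betweenD[OF cycle_nth(3,4)[OF C i] e]] by blast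
  qed
  ultimately show ?thesis unfolding starts_left_def by blast
qed

lemma starts_right_subdivision_iff:
  assumes C: "cycle H C"
  shows "starts_right (pd_completion H) (subdivision H C) x \<longleftrightarrow>
    (\<exists>i<length C. x = E2F (opp H (C ! i))) \<or>
    (\<exists>i<length C. \<exists>e. x = V2E e \<and> ccw_between H (opp H (C ! i)) (C ! (Suc i mod length C)) e)"
    (is "?l \<longleftrightarrow> ?E \<or> ?V")
proof -
  have "(\<exists>j<length (subdivision H C).
      ccw_between (pd_completion H) (opp (pd_completion H) (subdivision H C ! j))
        (subdivision H C ! (Suc j mod length (subdivision H C))) x) \<longleftrightarrow> ?E \<or> ?V"
    unfolding length_subdivision ex_less_double_iff
    using cycle_nth[OF C]
    by (auto simp: Suc_double_mod subdivision_nth subdivision_nth_next pd_opp_simps ccw_between_pd_edge' ccw_between_pd_vertex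
        cong: conj_cong)
  moreover have "x \<notin> set (subdivision H C) \<and> opp (pd_completion H) x \<notin> set (subdivision H C)"
    if "?E \<or> ?V"
    using that
  proof (elim disjE exE conjE)
    fix i assume "i < length C" "x = E2F (opp H (C ! i))"
    then show ?thesis using cycle_nth(1)[OF C] by (auto simp: set_subdivision pd_opp_simps)
  next
    fix i e assume i: "i < length C" and x: "x = V2E e"
      and e: "ccw_between H (opp H (C ! i)) (C ! (Suc i mod length C)) e"
    note n = cycle_nth(3,4)[OF C i]
    have "C ! (Suc i mod length C) \<in> tail H (opp H (C ! i))" using tail_eq[OF n(1)] tail_self by simp
    from ccw_betweenD[OF this n(2)[symmetric] e] tail_eq[OF n(1)]
    show ?thesis unfolding x using not_on_subdivision[OF C i, of e] by simp
  qed
  ultimately show ?thesis unfolding starts_right_def by blast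
qed

text \<open>Treats both sides at once: \<open>g\<close> is the identity on the left and
  \<open>opp H\<close> on the right, and \<open>a i\<close>, \<open>b i\<close> bound the sector.
  Sectors at different vertices are disjoint because no vertex of a cycle is repeated, and each
  sector sum telescopes.\<close>

lemma sum_one_side:
  fixes f :: "'d pd_dart \<Rightarrow> int" and p :: "'d \<Rightarrow> int"
  assumes C: "cycle H C"
    and f: "\<And>d. d \<in> darts H \<Longrightarrow> f (V2E d) = p d - p (prv H d)"
    and g: "inj_on g (set C)"
    and b: "\<And>i. i < length C \<Longrightarrow> b i \<in> tail H (a i)" and ab: "\<And>i. i < length C \<Longrightarrow> a i \<noteq> b i"
    and a: "\<And>i. i < length C \<Longrightarrow> tail H (a i) = tail H (C ! (Suc i mod length C))"
    and S: "\<And>x. x \<in> S \<longleftrightarrow> (\<exists>i<length C. x = E2F (g (C ! i))) \<or>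
      (\<exists>i<length C. \<exists>e. x = V2E e \<and> ccw_between H (a i) (b i) e)"
  shows "finite S" "(\<Sum>x\<in>S. f x) = (\<Sum>i<length C. f (E2F (g (C ! i))) + p (prv H (b i)) - p (a i))"
proof -
  let ?n = "length C"
  define A where "A i = {e. ccw_between H (a i) (b i) e}" for i
  have finA: "finite (A i)" if "i < ?n" for i
    unfolding A_def by (rule finite_ccw_between[OF b[OF that] ab[OF that]])
  have A_tail: "A i \<subseteq> tail H (C ! (Suc i mod ?n))" if "i < ?n" for i
    unfolding A_def using ccw_betweenD(1)[OF b[OF that] ab[OF that]] a[OF that] by auto
  have A_darts: "A i \<subseteq> darts H" if "i < ?n" for i
    using A_tail[OF that] tail_subset[OF cycle_nth(2)[OF C that]] by blast
  have disj: "A i \<inter> A j = {}" if "i < ?n" "j < ?n" "i \<noteq> j" for i j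
  proof (rule ccontr)
    assume "A i \<inter> A j \<noteq> {}"
    then obtain e where "e \<in> A i" "e \<in> A j" by blast
    then have "tail H (C ! (Suc i mod ?n)) = tail H (C ! (Suc j mod ?n))"
      using A_tail that(1,2) tail_eq by (metis subsetD)
    then show False using cycle_next_tail_inj[OF C that(1,2)] that(3) by simp
  qed
  have dC: "distinct C" using C by (simp add: cycle_def distinct_map)
  have injE: "inj_on (\<lambda>i. E2F (g (C ! i))) {..<?n}"
  proof (rule inj_onI)
    fix i j assume i: "i \<in> {..<?n}" and j: "j \<in> {..<?n}" and "E2F (g (C ! i)) = E2F (g (C ! j))"
    then have "C ! i = C ! j" using inj_onD[OF g, of "C ! i" "C ! j"] by simp
    then show "i = j" using nth_eq_iff_index_eq[OF dC] i j by simp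
  qed
  have Seq: "S = (\<lambda>i. E2F (g (C ! i))) ` {..<?n} \<union> V2E ` (\<Union>i\<in>{..<?n}. A i)"
    by (rule set_eqI) (unfold S A_def, blast)
  show "finite S" unfolding Seq using finA by auto
  have "(\<Sum>x\<in>S. f x) = (\<Sum>x\<in>(\<lambda>i. E2F (g (C ! i))) ` {..<?n}. f x) + (\<Sum>x\<in>V2E ` (\<Union>i\<in>{..<?n}. A i). f x)"
    unfolding Seq using finA by (intro sum.union_disjoint) auto
  also have "(\<Sum>x\<in>(\<lambda>i. E2F (g (C ! i))) ` {..<?n}. f x) = (\<Sum>i<?n. f (E2F (g (C ! i))))"
    by (simp add: sum.reindex[OF injE])
  also have "(\<Sum>x\<in>V2E ` (\<Union>i\<in>{..<?n}. A i). f x) = (\<Sum>e\<in>(\<Union>i\<in>{..<?n}. A i). f (V2E e))"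
    by (subst sum.reindex) (auto simp: inj_on_def)
  also have "\<dots> = (\<Sum>i<?n. \<Sum>e\<in>A i. f (V2E e))"
    using finA disj by (intro sum.UNION_disjoint) auto
  also have "\<dots> = (\<Sum>i<?n. p (prv H (b i)) - p (a i))"
  proof (rule sum.cong)
    fix i assume "i \<in> {..<?n}"
    then have i: "i < ?n" by simp
    have "(\<Sum>e\<in>A i. f (V2E e)) = (\<Sum>e\<in>A i. p e - p (prv H e))"
      using A_darts[OF i] by (intro sum.cong) (auto simp: f)
    then show "(\<Sum>e\<in>A i. f (V2E e)) = p (prv H (b i)) - p (a i)"
      unfolding A_def using ccw_between_sum[OF b[OF i] ab[OF i]] by simp
  qed simp
  finally show "(\<Sum>x\<in>S. f x) = (\<Sum>i<?n. f (E2F (g (C ! i))) + p (prv H (b i)) - p (a i))"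
    by (simp add: sum.distrib sum_subtractf)
qed

text \<open>
  For a conserved flow \<open>f\<close> with local potential \<open>p\<close> around the vertices, the transfer of a dart is
  the flow through a curve that runs along its left side, from a point near its tail to a point near
  its head.
\<close>

definition transfer :: "('d pd_dart \<Rightarrow> int) \<Rightarrow> ('d \<Rightarrow> int) \<Rightarrow> 'd \<Rightarrow> int" where
  "transfer f p d = f (F2E d) + p d - p (face_nxt H d)"

text \<open>The flow out of the cycle to the left is minus the total transfer. On the right the same
  computation applies to the opposite darts, and antisymmetry makes it plus the total transfer,
  hence the factor 2.\<close>

lemma gamma_diff:
  assumes D: "orientation (pd_completion H) D" "orientation (pd_completion H) D'"
    and f_def: "f = dart_flow (pd_completion H) (orientation_diff (pd_completion H) D D')"
    and p: "\<And>d. d \<in> darts H \<Longrightarrow> f (V2E d) = p d - p (prv H d)"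
    and anti: "\<And>d. d \<in> darts H \<Longrightarrow> transfer f p (opp H d) = - transfer f p d"
    and C: "cycle H C"
  shows "gamma H D C - gamma H D' C = 2 * sum_list (map (transfer f p) C)"
proof -
  let ?n = "length C" and ?s = "\<lambda>i. Suc i mod length C"
  have fopp: "f (E2F d) = - f (F2E d)" if "d \<in> darts H" for d
    using dart_flow_pd_opp[of "F2E d"] that by (simp add: f_def pd_opp_simps)
  have fD: "f x = of_bool (x \<in> D) - of_bool (x \<in> D')" if "x \<in> pd_darts H" for x
    using pd.dart_flow_orientation_diff[OF D] that by (simp add: f_def pd_completion_simps(1))
  note n = cycle_nth[OF C]
  \<comment> \<open>A sector involves the dart ending at a vertex and the dart starting there; this
    reindexing collects the terms by dart.\<close>
  have shift: "(\<Sum>i<?n. q (C ! ?s i)) = (\<Sum>i<?n. q (C ! i))" for q :: "'d \<Rightarrow> int"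
    by (rule sum.reindex_bij_betw[OF bij_betw_Suc_mod, of "\<lambda>i. q (C ! i)"])
  have sum_C: "(\<Sum>i<?n. q (C ! i)) = sum_list (map q C)" for q :: "'d \<Rightarrow> int"
    by (simp add: sum_list_sum_nth lessThan_atLeast0)
  define L where "L = {x. starts_left (pd_completion H) (subdivision H C) x}"
  define Rt where "Rt = {x. starts_right (pd_completion H) (subdivision H C) x}"
  have Lx: "x \<in> L \<longleftrightarrow> (\<exists>i<?n. x = E2F (id (C ! i))) \<or>
      (\<exists>i<?n. \<exists>e. x = V2E e \<and> ccw_between H (C ! ?s i) (opp H (C ! i)) e)" for x
    unfolding L_def using starts_left_subdivision_iff[OF C] by simp
  have Rx: "x \<in> Rt \<longleftrightarrow> (\<exists>i<?n. x = E2F (opp H (C ! i))) \<or>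
      (\<exists>i<?n. \<exists>e. x = V2E e \<and> ccw_between H (opp H (C ! i)) (C ! ?s i) e)" for x
    unfolding Rt_def using starts_right_subdivision_iff[OF C] by simp
  have oppinj: "inj_on (opp H) (set C)" using permutes_inj[OF opp_permutes] by (rule inj_on_subset) simp
  have tailo: "tail H (opp H (C ! i)) = tail H (C ! ?s i)" if "i < ?n" for i
    by (rule tail_eq[OF n(3)[OF that]])
  have memo: "C ! ?s i \<in> tail H (opp H (C ! i))" if "i < ?n" for i
    using tailo[OF that] tail_self by simp
  have "finite L \<and> (\<Sum>x\<in>L. f x) = (\<Sum>i<?n. f (E2F (id (C ! i))) + p (prv H (opp H (C ! i))) - p (C ! ?s i))"
    using sum_one_side[where f = f and p = p, OF C p inj_on_id n(3) n(4) refl Lx] by simp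
  moreover have "finite Rt \<and> (\<Sum>x\<in>Rt. f x) = (\<Sum>i<?n. f (E2F (opp H (C ! i))) + p (prv H (C ! ?s i)) - p (opp H (C ! i)))"
    using sum_one_side[where f = f and p = p, OF C p oppinj memo n(4)[symmetric] tailo Rx] by simp
  ultimately have fin: "finite L" "finite Rt"
    and sL: "(\<Sum>x\<in>L. f x) = (\<Sum>i<?n. f (E2F (C ! i)) + p (prv H (opp H (C ! i))) - p (C ! ?s i))"
    and sR: "(\<Sum>x\<in>Rt. f x) = (\<Sum>i<?n. f (E2F (opp H (C ! i))) + p (prv H (C ! ?s i)) - p (opp H (C ! i)))"
    by simp_all
  have "(\<Sum>x\<in>L. f x) = (\<Sum>i<?n. f (E2F (C ! i)) + p (face_nxt H (C ! i)) - p (C ! i))"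
    unfolding sL sum.distrib sum_subtractf shift face_nxt_def ..
  also have "\<dots> = (\<Sum>i<?n. - transfer f p (C ! i))"
    using n(1) by (intro sum.cong) (auto simp: transfer_def fopp)
  finally have left: "(\<Sum>x\<in>L. f x) = - sum_list (map (transfer f p) C)"
    by (simp add: sum_negf sum_C)
  have "(\<Sum>x\<in>Rt. f x) = (\<Sum>i<?n. f (E2F (opp H (C ! i))) + p (prv H (C ! i)) - p (opp H (C ! i)))"
    unfolding sR sum.distrib sum_subtractf shift[of "\<lambda>d. p (prv H d)"] ..
  also have "\<dots> = (\<Sum>i<?n. - transfer f p (opp H (C ! i)))"
    using n(1) by (intro sum.cong) (auto simp: transfer_def fopp face_nxt_def opp_opp)
  also have "\<dots> = (\<Sum>i<?n. transfer f p (C ! i))"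
    using n(1) by (intro sum.cong) (auto simp: anti)
  finally have right: "(\<Sum>x\<in>Rt. f x) = sum_list (map (transfer f p) C)"
    by (simp add: sum_C)
  have darts: "L \<subseteq> pd_darts H" "Rt \<subseteq> pd_darts H"
  proof -
    show "L \<subseteq> pd_darts H"
    proof
      fix x assume "x \<in> L"
      then show "x \<in> pd_darts H" unfolding Lx
      proof (elim disjE exE conjE)
        fix i e assume i: "i < ?n" and x: "x = V2E e" and e: "ccw_between H (C ! ?s i) (opp H (C ! i)) e"
        show ?thesis using ccw_betweenD(1)[OF n(3)[OF i] n(4)[OF i] e] tail_subset[OF n(2)[OF i]]
          by (auto simp: x)
      qed (simp add: n)
    qed
    show "Rt \<subseteq> pd_darts H"
    proof
      fix x assume "x \<in> Rt"
      then show "x \<in> pd_darts H" unfolding Rx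
      proof (elim disjE exE conjE)
        fix i e assume i: "i < ?n" and x: "x = V2E e" and e: "ccw_between H (opp H (C ! i)) (C ! ?s i) e"
        show ?thesis using ccw_betweenD(1)[OF memo[OF i] n(4)[OF i, symmetric] e] tail_subset[OF n(2)[OF i]]
          tailo[OF i] by (auto simp: x)
      qed (simp add: n)
    qed
  qed
  \<comment> \<open>\<open>f\<close> is the difference of the indicators of \<open>D\<close> and
    \<open>D'\<close>, so a difference of counts is a sum of \<open>f\<close>.\<close>
  have cnt: "int (card {x \<in> D. x \<in> A}) - int (card {x \<in> D'. x \<in> A}) = (\<Sum>x\<in>A. f x)"
    if A: "finite A" "A \<subseteq> pd_darts H" for A
  proof -
    have "int (card {x \<in> E. x \<in> A}) = (\<Sum>x\<in>A. of_bool (x \<in> E))" for E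
      using sum.inter_restrict[OF A(1), of "\<lambda>_. 1::int" E] by (simp add: of_bool_def Collect_conj_eq Int_commute)
    then show ?thesis using A(2) by (simp add: fD subset_eq flip: sum_subtractf)
  qed
  have "gamma H D C - gamma H D' C = (\<Sum>x\<in>Rt. f x) - (\<Sum>x\<in>L. f x)"
    using cnt[OF fin(1) darts(1)] cnt[OF fin(2) darts(2)] by (simp add: gamma_def L_def Rt_def)
  then show ?thesis using left right by simp
qed

section \<open>The three kinds of vertices and the construction of a potential\<close>

lemma pd_tail_V2E: "d \<in> darts H \<Longrightarrow> tail (pd_completion H) (V2E d) = V2E ` tail H d"
  unfolding tail_def
  by (rule orbit_inverse[symmetric, OF permutes_orbit_self[OF nxt_permutes finite_darts]])
    (use permutes_orbit_subset[OF nxt_permutes] in \<open>auto simp: pd_nxt_simps subset_eq\<close>)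

lemma pd_tail_F2E: "d \<in> darts H \<Longrightarrow> tail (pd_completion H) (F2E d) = F2E ` orbit (face_nxt H) d"
  unfolding tail_def
  by (rule orbit_inverse[symmetric, OF permutes_orbit_self[OF face_nxt_permutes finite_darts]])
    (use permutes_orbit_subset[OF face_nxt_permutes] in \<open>auto simp: pd_nxt_simps subset_eq\<close>)

lemma pd_tail_E2V:
  assumes d: "d \<in> darts H"
  shows "tail (pd_completion H) (E2V d) = {E2V d, E2F (opp H d), E2V (opp H d), E2F d}"
proof -
  let ?n = "nxt (pd_completion H)"
  have n: "?n (E2V d) = E2F (opp H d)" "?n (E2F (opp H d)) = E2V (opp H d)"
    "?n (E2V (opp H d)) = E2F d" "?n (E2F d) = E2V d"
    using d by (simp_all add: pd_nxt_simps opp_opp)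
  have "orbit ?n (E2V d) = {(?n ^^ m) (E2V d) | m. m < 4}"
    by (rule orbit_altdef_bounded) (simp_all add: eval_nat_numeral n)
  also have "\<dots> = (\<lambda>m. (?n ^^ m) (E2V d)) ` {0, 1, 2, 3}"
  proof -
    have "{..<4 :: nat} = {0, 1, 2, 3}" by auto
    moreover have "{(?n ^^ m) (E2V d) | m. m < 4} = (\<lambda>m. (?n ^^ m) (E2V d)) ` {..<4}" by blast
    ultimately show ?thesis by simp
  qed
  also have "\<dots> = {E2V d, E2F (opp H d), E2V (opp H d), E2F d}"
    by (simp add: eval_nat_numeral n)
  finally show ?thesis by (simp add: tail_def)
qed

text \<open>Conservation acts at each kind of vertex: primal-vertices give the local potential
  \<open>p\<close>, edge-vertices the antisymmetry of the transfer, dual-vertices its vanishing sum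
  around faces. As \<open>p\<close> is only built in the proof, the hypothesis on the basis is
  stated for every suitable \<open>p\<close>.\<close>

lemma exact_if_conserved_and_basis:
  fixes f :: "'d pd_dart \<Rightarrow> int"
  assumes R: "orientation H R" and basis: "homology_basis H R Bs"
    and anti: "\<And>x. x \<in> pd_darts H \<Longrightarrow> f (opp (pd_completion H) x) = - f x"
    and cons: "pd.conserved f"
    and Bs: "\<And>p B. (\<And>d. d \<in> darts H \<Longrightarrow> f (V2E d) = p d - p (prv H d)) \<Longrightarrow>
        (\<And>d. d \<in> darts H \<Longrightarrow> transfer f p (opp H d) = - transfer f p d) \<Longrightarrow>
        B \<in> set Bs \<Longrightarrow> sum_list (map (transfer f p) B) = 0"
  shows "pd_exact f"
proof -
  have tail_sum: "(\<Sum>e\<in>tail (pd_completion H) x. f e) = 0" if "x \<in> pd_darts H" for x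
    using cons that by (simp add: pd.conserved_def pd_completion_simps(1))
  have "(\<Sum>y\<in>orbit (nxt H) d. f (V2E y)) = 0" if d: "d \<in> darts H" for d
    using tail_sum[of "V2E d"] d
    by (simp add: pd_tail_V2E tail_def[of H] sum.reindex[of V2E] inj_on_def)
  then obtain p where p: "\<And>d. d \<in> darts H \<Longrightarrow> p d - p (inv (nxt H) d) = f (V2E d)"
    using potential_if_orbit_sums_zero[OF nxt_permutes finite_darts, of "\<lambda>d. f (V2E d)"] by blast
  then have p: "f (V2E d) = p d - p (prv H d)" if "d \<in> darts H" for d
    using that by (simp add: prv_def)
  define t where "t = transfer f p"
  have t_opp: "t (opp H d) = - t d" if d: "d \<in> darts H" for d
  proof -
    have "(\<Sum>e\<in>{E2V d, E2F (opp H d), E2V (opp H d), E2F d}. f e) = 0"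
      using tail_sum[of "E2V d"] d pd_tail_E2V[OF d] by simp
    then have "f (E2V d) + f (E2F (opp H d)) + f (E2V (opp H d)) + f (E2F d) = 0"
      using opp_neq[OF d] by simp
    moreover have "f (E2V e) = - f (V2E e)" "f (E2F e) = - f (F2E e)" if "e \<in> darts H" for e
      using anti[of "V2E e"] anti[of "F2E e"] that by (simp_all add: pd_opp_simps)
    ultimately have "f (V2E d) + f (F2E (opp H d)) + f (V2E (opp H d)) + f (F2E d) = 0"
      using d by simp
    then show ?thesis
      using p[of d] p[of "opp H d"] d by (simp add: t_def transfer_def face_nxt_def opp_opp)
  qed
  have t_face: "(\<Sum>e\<in>orbit (face_nxt H) d. t e) = 0" if d: "d \<in> darts H" for d
  proof -
    have "(\<Sum>y\<in>orbit (face_nxt H) d. f (F2E y)) = 0"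
      using tail_sum[of "F2E d"] d
      by (simp add: pd_tail_F2E sum.reindex[of F2E] inj_on_def)
    then show ?thesis
      using sum_orbit_shift[OF face_nxt_permutes finite_darts, of p d]
      by (simp add: t_def transfer_def sum.distrib sum_subtractf)
  qed
  have "sum_list (map t B) = 0" if "B \<in> set Bs" for B
    unfolding t_def by (rule Bs[OF p]) (use t_opp that in \<open>auto simp: t_def\<close>)
  then have "sum_list (map t w) = 0" if "closed_walk H w" for w
    using closed_walk_sum_zero_if_basis[of R Bs t w] R basis t_opp t_face that by blast
  then obtain q where q: "\<And>d. d \<in> darts H \<Longrightarrow> t d = q (head H d) - q (tail H d)"
    using potential_if_closed_walk_sums_zero[of t] t_opp by blast
  show ?thesis
  proof (rule pd_exactI)
    fix d assume d: "d \<in> darts H"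
    \<comment> \<open>The correction \<open>q\<close> is constant around a vertex, so it does not
      disturb the values at \<open>V2E\<close>, while its increments supply the transfer missing at
      \<open>F2E\<close>.\<close>
    show "f (V2E d) = p d + q (tail H d) - (p (prv H d) + q (tail H (prv H d)))"
      using p[OF d] by (simp add: tail_prv)
    have "tail H (face_nxt H d) = head H d" by (simp add: face_nxt_def tail_prv head_def)
    then show "f (F2E d) = p (face_nxt H d) + q (tail H (face_nxt H d)) - (p d + q (tail H d))"
      using q[OF d] by (simp add: t_def transfer_def)
  qed
qed

text \<open>Equal types force the total transfer along each basis cycle to vanish, since twice it is
  0. Conversely, an integer potential can be reduced modulo 3, is conserved, and has zero
  transfer.\<close>

lemma zero_homologous_iff_same_type:
  assumes D: "orientation (pd_completion H) D" "orientation (pd_completion H) D'"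
    and R: "orientation H R" and R': "orientation (pd_completion H) R'"
    and S: "schnyder_orientation H D"
    and T: "T = orientation_diff (pd_completion H) D D'"
    and Bs: "\<forall>B\<in>set Bs. cycle H B" "homology_basis H R Bs"
  shows "schnyder_orientation H D' \<and> same_outdegrees (pd_completion H) D D' \<and>
      orientation_type H Bs D = orientation_type H Bs D' \<longleftrightarrow>
    zero_homologous (pd_completion H) R' T"
proof -
  define f where "f = dart_flow (pd_completion H) (orientation_diff (pd_completion H) D D')"
  have zh: "zero_homologous (pd_completion H) R' T \<longleftrightarrow> pd_exact f"
    by (simp add: pd_zero_homologous_iff[OF R'] f_def T)
  have out: "same_outdegrees (pd_completion H) D D' \<longleftrightarrow> pd.conserved f"
    by (simp add: pd.same_outdegrees_iff[OF D] f_def)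
  have anti: "f (opp (pd_completion H) x) = - f x" if "x \<in> pd_darts H" for x
    using dart_flow_pd_opp[OF that] by (simp add: f_def)
  have type: "orientation_type H Bs D = orientation_type H Bs D' \<longleftrightarrow>
    (\<forall>B\<in>set Bs. gamma H D B = gamma H D' B)" by (simp add: orientation_type_def)
  show ?thesis unfolding zh out type
  proof
    assume *: "schnyder_orientation H D' \<and> pd.conserved f \<and> (\<forall>B\<in>set Bs. gamma H D B = gamma H D' B)"
    show "pd_exact f"
    proof (rule exact_if_conserved_and_basis[OF R Bs(2)])
      fix p B
      assume "\<And>d. d \<in> darts H \<Longrightarrow> f (V2E d) = p d - p (prv H d)"
        "\<And>d. d \<in> darts H \<Longrightarrow> transfer f p (opp H d) = - transfer f p d" "B \<in> set Bs"
      then show "sum_list (map (transfer f p) B) = 0"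
        using gamma_diff[OF D f_def, of p B] * Bs(1) by simp
    qed (use anti * in auto)
  next
    assume exact: "pd_exact f"
    have "schnyder_orientation H D'"
      using pd_exact_of_int[OF exact] schnyder_orientation_iff_diff_exact[OF D S] by (simp add: f_def)
    moreover have "pd.conserved f" using anti exact by (rule pd_exact_conserved)
    moreover have "gamma H D B = gamma H D' B" if B: "B \<in> set Bs" for B
    proof -
      obtain k where k: "\<And>d. d \<in> darts H \<Longrightarrow> f (V2E d) = k d - k (prv H d)"
        "\<And>d. d \<in> darts H \<Longrightarrow> f (F2E d) = k (face_nxt H d) - k d"
        using exact unfolding pd_exact_def by blast
      \<comment> \<open>The angle potential \<open>k\<close> also serves as local potential around
        the vertices, and its equation at \<open>F2E d\<close> says exactly that the transfer is
        0.\<close>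
      have t: "transfer f k d = 0" if "d \<in> darts H" for d using k(2)[OF that] by (simp add: transfer_def)
      have C: "cycle H B" using Bs(1) B by blast
      then have "set B \<subseteq> darts H" by (simp add: cycle_def closed_walk_def)
      then have "sum_list (map (transfer f k) B) = 0" using t by (induction B) auto
      then show ?thesis using gamma_diff[OF D f_def k(1) _ C] t by simp
    qed
    ultimately show "schnyder_orientation H D' \<and> pd.conserved f \<and> (\<forall>B\<in>set Bs. gamma H D B = gamma H D' B)"
      by blast
  qed
qed

end

theorem theorem30:
  fixes G :: "'d cmap" and R :: "'d set" and R' D D' T :: "'d pd_dart set"
  assumes "surface_map G"
    and "orientation G R" and "orientation (pd_completion G) R'"
    and "orientation (pd_completion G) D" and "orientation (pd_completion G) D'"
    and "schnyder_orientation G D"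
    and "T = orientation_diff (pd_completion G) D D'"
  shows "(schnyder_orientation G D' \<longleftrightarrow> partitionable (pd_completion G) R' T) \<and>
    (schnyder_orientation G D' \<and> same_outdegrees (pd_completion G) D D' \<longleftrightarrow>
       eulerian_partitionable (pd_completion G) R' T) \<and>
    (\<forall>Bs. length Bs = 2 * genus G \<and> (\<forall>B\<in>set Bs. cycle G B) \<and> homology_basis G R Bs \<longrightarrow>
       (schnyder_orientation G D' \<and> same_outdegrees (pd_completion G) D D' \<and>
          orientation_type G Bs D = orientation_type G Bs D' \<longleftrightarrow>
        zero_homologous (pd_completion G) R' T))"
proof -
  interpret comb_map G using assms(1) by unfold_locales (simp add: surface_map_def)
  show ?thesis
    using schnyder_iff_partitionable[OF assms(4,5,3,6,7)]
      zero_homologous_iff_same_type[OF assms(4,5,2,3,6,7)]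
    by blast
qed

end
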